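(* For every integer $s\ge1$ and every complex $q$ with $|q|<1$, $$\sum_{\substack{n_s\ge\cdots\ge n_1\ge0\\ l_s\ge\cdots\ge l_1\ge0\\ k_s\ge\cdots\ge k_1\ge0}}\frac{q^{n_1^2+\cdots+n_s^2+l_1^2+\cdots+l_s^2+k_1^2+\cdots+k_s^2+n_1+\cdots+n_s+l_1+\cdots+l_s+k_1+\cdots+k_s}}{(q;q)_{n_s-n_{s-1}}\cdots(q;q)_{n_2-n_1}\,(q;q)_{l_s-l_{s-1}}\cdots(q;q)_{l_2-l_1}\,(q;q)_{k_s-k_{s-1}}\cdots(q;q)_{k_2-k_1}}$$ $$\times\frac{(q^2;q)_{n_1+l_1+k_1}}{(q^2;q)_{n_1+l_1}(q^2;q)_{n_1+k_1}(q^2;q)_{l_1+k_1}(q;q)_{n_1}(q;q)_{l_1}(q;q)_{k_1}}=\frac{1}{(q^2;q)_\infty^2}\prod_{\substack{m\ge1\\ m\not\equiv0,\pm1\ (\mathrm{mod}\ 6s+3)}}\frac{1}{1-q^m}.$$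
   Context: Notation: $(x;q)_n=\prod_{j=0}^{n-1}(1-xq^j)$ for integers $n\ge0$, and $(x;q)_\infty=\prod_{j\ge0}(1-xq^j)$. The sum is over integers $n_i,l_i,k_i$ ($1\le i\le s$); for $s=1$ the products of difference factors are empty (equal to 1). *)

theory Defs
  imports "HOL-Analysis.Analysis" "HOL-Number_Theory.Cong"
begin

definition qpoch :: "complex \<Rightarrow> complex \<Rightarrow> nat \<Rightarrow> complex" where
  "qpoch x q n = (\<Prod>j<n. 1 - x * q ^ j)"

definition qpoch_inf :: "complex \<Rightarrow> complex \<Rightarrow> complex" where
  "qpoch_inf x q = (\<Prod>j. 1 - x * q ^ j)"

(* The tuples n_s \<ge> \<dots> \<ge> n_1 \<ge> 0, as functions on {1..s} that are
   undefined elsewhere, so that every tuple is represented exactly once. *)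
definition nondec_tuples :: "nat \<Rightarrow> (nat \<Rightarrow> nat) set" where
  "nondec_tuples s = {n \<in> {1..s} \<rightarrow>\<^sub>E UNIV. mono_on {1..s} n}"

definition tuple_weight :: "nat \<Rightarrow> (nat \<Rightarrow> nat) \<Rightarrow> nat" where
  "tuple_weight s n = (\<Sum>i=1..s. n i ^ 2) + (\<Sum>i=1..s. n i)"

(* The subtraction of naturals is exact for n in nondec_tuples s. *)
definition diff_prod :: "complex \<Rightarrow> nat \<Rightarrow> (nat \<Rightarrow> nat) \<Rightarrow> complex" where
  "diff_prod q s n = (\<Prod>i=2..s. qpoch q q (n i - n (i - 1)))"

end

theory Submission
  imports Defs
begin

text \<open>
  A terminating \<open>6\<phi>5\<close> summation expands the kernel in \<open>n\<^sub>1, l\<^sub>1, k\<^sub>1\<close> as a single sum over \<open>r\<close> of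
  \<open>\<alpha>\<^sub>r\<close> times a product of three factors \<open>1 / ((q; q)\<^bsub>n-r\<^esub> (q\<^sup>2; q)\<^bsub>n+r\<^esub>)\<close>, one for each variable.
  After exchanging summations, each of the three multisums is, for fixed \<open>r\<close>, an iteration of the
  Bailey lemma at \<open>a = q\<close> and has the value \<open>q\<^bsup>s(r\<^sup>2+r)\<^esup> / (q\<^sup>2; q)\<^sub>\<infinity>\<close>. What remains is the theta series
  \<open>\<Sum> \<alpha>\<^sub>r q\<^bsup>3s(r\<^sup>2+r)\<^esup>\<close>, which the Jacobi triple product with base \<open>q\<^bsup>6s+3\<^esup>\<close> evaluates.
\<close>

section \<open>The terminating \<open>6\<phi>5\<close> sum\<close>

text \<open>The obstacle is the kernel: it couples \<open>n 1\<close>, \<open>l 1\<close> and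
  \<open>k 1\<close>, so the triple multisum does not factor. Each term of the expansion in
  \<open>r\<close> does factor, but the price is a new infinite summation that must be exchanged
  with all the others. Hence the bounds on the chain terms are uniform in \<open>r\<close>, and the
  decay in \<open>r\<close> comes from \<open>dixon_alpha\<close> alone. The modulus arises from r^2
  + r = 2 * (r+1 choose 2): the exponent r^2 + (r+1 choose 2) + 3s(r^2 + r) equals (6s+3) * (r+1
  choose 2) - r, which is the triple product exponent for base q^(6s+3) and argument q. Shifted
  factorials are written as (q;q)_(m+1) = (1-q) (q^2;q)_m, so that only one base point occurs. The
  surplus powers of 1-q are removed at the very end. The weights 1/((q;q)_(n-r) (q;q)_(n+r+1)) play
  two roles: they carry the Bailey chain, and with q replaced by w they are the central Gaussian
  binomials in the finite triple product.\<close>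

lemma qpoch_0 [simp]: "qpoch x q 0 = 1"
  by (simp add: qpoch_def)

lemma qpoch_Suc: "qpoch x q (Suc n) = qpoch x q n * (1 - x * q ^ n)"
  by (simp add: qpoch_def)

lemma qpoch_self_Suc: "qpoch q q (Suc n) = qpoch q q n * (1 - q ^ Suc n)"
  by (simp add: qpoch_Suc)

lemma qpoch_square: "(1 - q) * qpoch (q ^ 2) q n = qpoch q q (Suc n)"
  by (induction n) (simp_all add: qpoch_Suc power2_eq_square mult.assoc)

text \<open>The convention \<open>1 / (q; q)\<^sub>m = 0\<close> for negative \<open>m = n - r\<close>.\<close>
definition rqfact :: "complex \<Rightarrow> nat \<Rightarrow> nat \<Rightarrow> complex" where
  "rqfact q n r = (if r \<le> n then 1 / qpoch q q (n - r) else 0)"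

lemma rqfact_Suc_Suc [simp]: "rqfact q (Suc n) (Suc r) = rqfact q n r"
  by (simp add: rqfact_def)

lemma rqfact_add [simp]: "rqfact q (r + n) r = 1 / qpoch q q n"
  by (simp add: rqfact_def)

lemma rqfact_eq_0 [simp]: "n < r \<Longrightarrow> rqfact q n r = 0"
  by (simp add: rqfact_def)

text \<open>The summand of the terminating very-well-poised \<open>6\<phi>5\<close> series with \<open>a = q\<close>, up to the
  factors that depend on the three terminating parameters and up to \<open>1 / (1 - q)\<close>.\<close>
definition dixon_alpha :: "complex \<Rightarrow> nat \<Rightarrow> complex" where
  "dixon_alpha q r = (-1) ^ r * q ^ (r ^ 2 + (Suc r choose 2)) * (1 - q ^ (2 * r + 1))"

context
  fixes q :: complex
  assumes q: "norm q < 1"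
begin

lemma power_neq_one: "q ^ Suc n \<noteq> 1"
proof
  assume "q ^ Suc n = 1"
  hence "norm q ^ Suc n = 1"
    by (metis norm_one norm_power)
  moreover have "norm q ^ Suc n < 1"
    using power_Suc_le_self[of "norm q" n] q by simp
  ultimately show False by simp
qed

lemma qpoch_nonzero [simp]: "qpoch q q n \<noteq> 0"
proof (induction n)
  case (Suc n)
  then show ?case
    using power_neq_one[of n] by (simp add: qpoch_self_Suc del: power_Suc)
qed simp

lemma rqfact_Suc_right: "rqfact q n (Suc r) = (1 - q ^ (n - r)) * rqfact q n r"
proof (cases "r < n")
  case True
  then obtain m where "n = r + Suc m"
    by (auto simp: less_iff_Suc_add)
  thus ?thesis
    using power_neq_one[of m] by (simp add: rqfact_def qpoch_self_Suc del: power_Suc)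
qed (auto simp: rqfact_def)

lemma recip_qpoch_Suc:
  "inverse (qpoch q q n) = (1 - q ^ Suc n) * inverse (qpoch q q (Suc n))"
  using power_neq_one[of n] by (simp add: qpoch_self_Suc del: power_Suc)

definition dixon_term :: "nat \<Rightarrow> nat \<Rightarrow> nat \<Rightarrow> nat \<Rightarrow> complex" where
  "dixon_term l k n r = dixon_alpha q r * (rqfact q n r / qpoch q q (n + r + 1))
     * (rqfact q l r / qpoch q q (l + r + 1)) * (rqfact q k r / qpoch q q (k + r + 1))"

text \<open>The certificate of the first-order recurrence in \<open>n\<close> satisfied by the sum of
  \<open>dixon_term l k n\<close>, as found by creative telescoping.\<close>
definition dixon_cert :: "nat \<Rightarrow> nat \<Rightarrow> nat \<Rightarrow> nat \<Rightarrow> complex" where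
  "dixon_cert l k n r = - ((-1) ^ r * q ^ (n + 1) * q ^ (r ^ 2 + (r choose 2)) * (1 - q ^ r))
     * (rqfact q (n + 1) r / qpoch q q (n + r + 1))
     * (rqfact q l r / qpoch q q (l + r)) * (rqfact q k r / qpoch q q (k + r))"

lemma dixon_telescope:
  "(1 - q ^ (n + l + 2)) * (1 - q ^ (n + k + 2)) * (1 - q ^ (n + 1)) * dixon_term l k (n + 1) r
   - (1 - q ^ (n + l + k + 2)) * dixon_term l k n r
   = dixon_cert l k n (Suc r) - dixon_cert l k n r"
proof (cases "r \<le> n + 1 \<and> r \<le> l \<and> r \<le> k")
  case False
  then show ?thesis
    by (auto simp: dixon_term_def dixon_cert_def rqfact_def)
next
  case True
  \<comment> \<open>Writing \<open>n + 1\<close>, and not \<open>n\<close>, as \<open>r + a\<close>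
    keeps the boundary index r = n+1 in this case. There a = 0, so the factor \<open>1 - A\<close>
    below is zero, in agreement with \<open>rqfact q n r = 0\<close>.\<close>
  then obtain a b c where abc: "n + 1 = r + a" "l = r + b" "k = r + c"
    by (metis le_Suc_ex)
  define x A B C where defs: "x = q ^ r" "A = q ^ a" "B = q ^ b" "C = q ^ c"
  define ia ib ic where i: "ia = 1 / qpoch q q a" "ib = 1 / qpoch q q b" "ic = 1 / qpoch q q c"
  define da db dc where d: "da = inverse (qpoch q q (n + r + 2))"
    "db = inverse (qpoch q q (l + r + 1))" "dc = inverse (qpoch q q (k + r + 1))"
  define e y where ey: "e = (-1 :: complex) ^ r" "y = q ^ (r ^ 2 + (r choose 2))"
  have powers: "q ^ (n + 1) = x * A" "q ^ (n + l + 2) = q * x ^ 2 * A * B"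
    "q ^ (n + k + 2) = q * x ^ 2 * A * C" "q ^ (n + l + k + 2) = q * x ^ 3 * A * B * C"
    "q ^ (n + r + 2) = q * x ^ 2 * A" "q ^ (l + r + 1) = q * x ^ 2 * B"
    "q ^ (k + r + 1) = q * x ^ 2 * C" "q ^ (2 * r + 1) = q * x ^ 2"
  proof -
    have "n + l + 2 = 1 + 2 * r + a + b" "n + k + 2 = 1 + 2 * r + a + c"
      "n + l + k + 2 = 1 + 3 * r + a + b + c" "n + r + 2 = 1 + 2 * r + a"
      using abc by auto
    thus "q ^ (n + l + 2) = q * x ^ 2 * A * B" "q ^ (n + k + 2) = q * x ^ 2 * A * C"
      "q ^ (n + l + k + 2) = q * x ^ 3 * A * B * C" "q ^ (n + r + 2) = q * x ^ 2 * A"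
      unfolding defs by (simp_all only: power_add power_mult[symmetric] mult.commute power_one_right)
    show "q ^ (n + 1) = x * A"
      unfolding defs abc by (simp add: power_add)
    have "l + r + 1 = 1 + 2 * r + b" "k + r + 1 = 1 + 2 * r + c" "2 * r + 1 = 1 + 2 * r"
      using abc by auto
    thus "q ^ (l + r + 1) = q * x ^ 2 * B" "q ^ (k + r + 1) = q * x ^ 2 * C"
      "q ^ (2 * r + 1) = q * x ^ 2"
      unfolding defs by (simp_all only: power_add power_mult[symmetric] mult.commute power_one_right)
  qed
  have alpha: "dixon_alpha q r = e * (y * x) * (1 - q * x ^ 2)"
    unfolding dixon_alpha_def ey powers
    by (simp add: numeral_2_eq_2 power_add defs mult_ac)
  have y': "q ^ (Suc r ^ 2 + (Suc r choose 2)) = y * (q * x ^ 3)"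
  proof -
    have "Suc r ^ 2 + (Suc r choose 2) = (r ^ 2 + (r choose 2)) + (1 + 3 * r)"
      by (simp add: numeral_2_eq_2)
    thus ?thesis
      unfolding ey defs by (simp only: power_add power_mult[symmetric] mult.commute power_one_right)
  qed
  have ia: "rqfact q (n + 1) r = ia" "rqfact q n r = (1 - A) * ia"
    "rqfact q (n + 1) (Suc r) = (1 - A) * ia"
    "rqfact q l r = ib" "rqfact q l (Suc r) = (1 - B) * ib"
    "rqfact q k r = ic" "rqfact q k (Suc r) = (1 - C) * ic"
  proof -
    show 1: "rqfact q (n + 1) r = ia"
      by (simp only: abc i rqfact_add)
    have 2: "rqfact q (n + 1) (Suc r) = (1 - q ^ (n + 1 - r)) * rqfact q (n + 1) r"
      by (rule rqfact_Suc_right)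
    show 3: "rqfact q (n + 1) (Suc r) = (1 - A) * ia"
      by (subst 2, subst 1) (simp add: abc(1)[simplified] defs)
    thus "rqfact q n r = (1 - A) * ia" by simp
    show "rqfact q l r = ib" "rqfact q k r = ic"
      by (simp_all add: abc i)
    thus "rqfact q l (Suc r) = (1 - B) * ib" "rqfact q k (Suc r) = (1 - C) * ic"
      by (simp_all add: rqfact_Suc_right abc defs)
  qed
  have "inverse (qpoch q q (n + r + 1)) = (1 - q ^ (n + r + 2)) * da"
    "inverse (qpoch q q (l + r)) = (1 - q ^ (l + r + 1)) * db"
    "inverse (qpoch q q (k + r)) = (1 - q ^ (k + r + 1)) * dc"
    using recip_qpoch_Suc[of "n + r + 1"] recip_qpoch_Suc[of "l + r"] recip_qpoch_Suc[of "k + r"]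
    by (simp_all add: d)
  note da = this[unfolded powers]
  have da': "inverse (qpoch q q (n + 1 + r + 1)) = da" "inverse (qpoch q q (n + Suc r + 1)) = da"
    "inverse (qpoch q q (l + Suc r)) = db" "inverse (qpoch q q (k + Suc r)) = dc"
    by (simp_all add: d)
  \<comment> \<open>What remains of the telescoping relation once the common reciprocals
    \<open>ia\<close>, \<open>ib\<close>, \<open>ic\<close>, \<open>da\<close>, \<open>db\<close>,
    \<open>dc\<close> and the factor \<open>e * y\<close> are pulled out: a polynomial identity in
    q, x = q^r and A, B, C.\<close>
  have core: "x * (1 - q * x ^ 2) * ((1 - q * x ^ 2 * A * B) * (1 - q * x ^ 2 * A * C) * (1 - x * A)
      - (1 - q * x ^ 3 * A * B * C) * (1 - A) * (1 - q * x ^ 2 * A))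
    = x * A * (q * x ^ 3 * (1 - q * x) * (1 - A) * (1 - B) * (1 - C)
      + (1 - x) * (1 - q * x ^ 2 * A) * (1 - q * x ^ 2 * B) * (1 - q * x ^ 2 * C))"
    by algebra
  have t: "dixon_term l k n r = e * (y * x) * (1 - q * x ^ 2) * ((1 - A) * ia * ((1 - q * x ^ 2 * A) * da))
     * (ib * db) * (ic * dc)"
    unfolding dixon_term_def alpha ia divide_inverse by (simp only: da d)
  have t': "dixon_term l k (n + 1) r = e * (y * x) * (1 - q * x ^ 2) * (ia * da) * (ib * db) * (ic * dc)"
    unfolding dixon_term_def alpha ia divide_inverse by (simp only: da' d)
  have g: "dixon_cert l k n r = - (e * (x * A) * y * (1 - x)) * (ia * ((1 - q * x ^ 2 * A) * da))
     * (ib * ((1 - q * x ^ 2 * B) * db)) * (ic * ((1 - q * x ^ 2 * C) * dc))"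
    unfolding dixon_cert_def divide_inverse
    by (simp only: da ia powers ey defs)
  have g': "dixon_cert l k n (Suc r) = e * (x * A) * (y * (q * x ^ 3)) * (1 - q * x) * ((1 - A) * ia * da)
     * ((1 - B) * ib * db) * ((1 - C) * ic * dc)"
    unfolding dixon_cert_def divide_inverse y' ia da' powers
    by (simp add: ey defs)
  have "(1 - q ^ (n + l + 2)) * (1 - q ^ (n + k + 2)) * (1 - q ^ (n + 1)) * dixon_term l k (n + 1) r
      - (1 - q ^ (n + l + k + 2)) * dixon_term l k n r
    = (e * y * (ia * ib * ic * da * db * dc)) *
      (x * (1 - q * x ^ 2) * ((1 - q * x ^ 2 * A * B) * (1 - q * x ^ 2 * A * C) * (1 - x * A)
      - (1 - q * x ^ 3 * A * B * C) * (1 - A) * (1 - q * x ^ 2 * A)))"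
    unfolding t t' powers by algebra
  also have "\<dots> = dixon_cert l k n (Suc r) - dixon_cert l k n r"
    unfolding core g g' by algebra
  finally show ?thesis .
qed

text \<open>The telescoped sum vanishes at both ends: the certificate contains 1 - q^r, which is 0
  at r = 0, and \<open>rqfact q l r\<close>, which is 0 at r = l+1. This leaves a first-order
  recurrence in \<open>n\<close> that the closed form also satisfies. At n = 0 only the term r = 0
  survives.\<close>

lemma dixon_sum:
  "(\<Sum>r\<le>l. dixon_term l k n r) =
     qpoch q q (n + l + k + 1) / (qpoch q q (n + l + 1) * qpoch q q (n + k + 1)
       * qpoch q q (l + k + 1) * qpoch q q n * qpoch q q l * qpoch q q k)"
proof (induction n)
  case 0
  have "(\<Sum>r\<le>l. dixon_term l k 0 r) = (\<Sum>r\<in>{0}. dixon_term l k 0 r)"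
    by (intro sum.mono_neutral_right) (auto simp: dixon_term_def)
  also have "\<dots> = 1 / (qpoch q q l * qpoch q q (l + 1) * qpoch q q k * qpoch q q (k + 1))"
    using power_neq_one[of 0]
    by (simp add: dixon_term_def dixon_alpha_def rqfact_def qpoch_Suc numeral_2_eq_2)
  finally show ?case by (simp add: field_simps)
next
  case (Suc n)
  let ?S = "\<lambda>n. \<Sum>r\<le>l. dixon_term l k n r"
  have "(1 - q ^ (n + l + 2)) * (1 - q ^ (n + k + 2)) * (1 - q ^ (n + 1)) * ?S (n + 1)
      - (1 - q ^ (n + l + k + 2)) * ?S n = (\<Sum>r\<le>l. dixon_cert l k n (Suc r) - dixon_cert l k n r)"
    unfolding sum_distrib_left sum_subtractf[symmetric]
    by (intro sum.cong refl dixon_telescope)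
  also have "\<dots> = dixon_cert l k n (Suc l) - dixon_cert l k n 0"
    unfolding lessThan_Suc_atMost[symmetric] by (rule sum_lessThan_telescope)
  also have "\<dots> = 0"
    by (simp add: dixon_cert_def)
  finally have rec: "(1 - q ^ (n + l + 2)) * (1 - q ^ (n + k + 2)) * (1 - q ^ (n + 1)) * ?S (n + 1)
      = (1 - q ^ (n + l + k + 2)) * ?S n" by simp
  have nz: "1 - q ^ (n + l + 2) \<noteq> 0" "1 - q ^ (n + k + 2) \<noteq> 0" "1 - q ^ (n + 1) \<noteq> 0"
    using power_neq_one[of "n + l + 1"] power_neq_one[of "n + k + 1"] power_neq_one[of n] by auto
  have "?S (n + 1) = (1 - q ^ (n + l + k + 2)) * ?S n
      / ((1 - q ^ (n + l + 2)) * (1 - q ^ (n + k + 2)) * (1 - q ^ (n + 1)))"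
    unfolding rec[symmetric] using nz by simp
  also have "\<dots> = qpoch q q (Suc n + l + k + 1) / (qpoch q q (Suc n + l + 1) * qpoch q q (Suc n + k + 1)
       * qpoch q q (l + k + 1) * qpoch q q (Suc n) * qpoch q q l * qpoch q q k)"
    unfolding Suc.IH by (simp add: qpoch_self_Suc mult_ac)
  finally show ?case by simp
qed

text \<open>The q-Vandermonde sum with one upper index sent to infinity. The induction on
  \<open>N\<close> needs \<open>c\<close> arbitrary, because one half of the split sum reappears
  with c+1.\<close>

lemma bailey_finite:
  "(\<Sum>j\<le>N. q ^ (j ^ 2 + c * j) / (qpoch q q j * qpoch q q (N - j) * qpoch q q (j + c)))
     = 1 / (qpoch q q N * qpoch q q (N + c))"
proof (induction N arbitrary: c)
  case (Suc N)
  let ?t = "\<lambda>N c j. q ^ (j ^ 2 + c * j) / (qpoch q q j * qpoch q q (N - j) * qpoch q q (j + c))"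
  let ?a = "\<lambda>j. q ^ (j ^ 2 + c * j) * (1 - q ^ (Suc N - j))
    / (qpoch q q j * qpoch q q (Suc N - j) * qpoch q q (j + c))"
  let ?b = "\<lambda>j. q ^ (j ^ 2 + c * j) * (q ^ (Suc N - j) * (1 - q ^ j))
    / (qpoch q q j * qpoch q q (Suc N - j) * qpoch q q (j + c))"
  \<comment> \<open>Split 1 - q^(N+1) = (1 - q^(N+1-j)) + q^(N+1-j) (1 - q^j). The first part
    cancels against (q;q)_(N+1-j) and lowers N; the second cancels against (q;q)_j, and the shift of
    j turns c into c+1.\<close>
  have "(1 - q ^ Suc N) * (\<Sum>j\<le>Suc N. ?t (Suc N) c j) = (\<Sum>j\<le>Suc N. ?a j + ?b j)"
    unfolding sum_distrib_left
  proof (intro sum.cong refl)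
    fix j assume "j \<in> {..Suc N}"
    hence "q ^ Suc N = q ^ (Suc N - j) * q ^ j"
      by (simp add: power_add[symmetric] del: power_Suc)
    thus "(1 - q ^ Suc N) * ?t (Suc N) c j = ?a j + ?b j"
      by (simp add: add_divide_distrib[symmetric] algebra_simps del: power_Suc)
  qed
  also have "\<dots> = sum ?a {..Suc N} + sum ?b {..Suc N}"
    by (rule sum.distrib)
  also have "sum ?a {..Suc N} = (\<Sum>j\<le>N. ?t N c j)"
    unfolding sum.atMost_Suc
  proof (simp, intro sum.cong refl)
    fix j assume "j \<in> {..N}"
    hence "Suc N - j = Suc (N - j)" by auto
    thus "?a j = ?t N c j"
      using power_neq_one[of "N - j"] by (simp add: qpoch_self_Suc del: power_Suc)
  qed
  also have "sum ?b {..Suc N} = (\<Sum>j\<le>N. ?b (Suc j))"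
    unfolding sum.atMost_Suc_shift by simp
  also have "\<dots> = (\<Sum>j\<le>N. q ^ (Suc N + c) * ?t N (Suc c) j)"
  proof (intro sum.cong refl)
    fix j assume j: "j \<in> {..N}"
    have "Suc j ^ 2 + c * Suc j + (N - j) = (Suc N + c) + (j ^ 2 + Suc c * j)"
      using j by (simp add: power2_eq_square algebra_simps)
    hence "q ^ (Suc j ^ 2 + c * Suc j) * q ^ (N - j) = q ^ (Suc N + c) * q ^ (j ^ 2 + Suc c * j)"
      by (simp only: power_add[symmetric])
    thus "?b (Suc j) = q ^ (Suc N + c) * ?t N (Suc c) j"
      using power_neq_one[of j] by (simp add: qpoch_self_Suc mult.assoc[symmetric] del: power_Suc)
  qed
  also have "\<dots> = q ^ (Suc N + c) * (\<Sum>j\<le>N. ?t N (Suc c) j)"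
    by (rule sum_distrib_left[symmetric])
  finally have "(1 - q ^ Suc N) * (\<Sum>j\<le>Suc N. ?t (Suc N) c j)
      = 1 / (qpoch q q N * qpoch q q (N + c)) + q ^ (Suc N + c) / (qpoch q q N * qpoch q q (N + Suc c))"
    unfolding Suc.IH by simp
  also have "\<dots> = 1 / (qpoch q q N * qpoch q q (Suc N + c))"
    using power_neq_one[of "N + c"] by (simp add: qpoch_self_Suc field_simps del: power_Suc)
  finally have "(\<Sum>j\<le>Suc N. ?t (Suc N) c j) = 1 / (qpoch q q N * qpoch q q (Suc N + c)) / (1 - q ^ Suc N)"
    using power_neq_one[of N] by (simp add: field_simps del: power_Suc)
  thus ?case by (simp add: qpoch_self_Suc mult_ac del: power_Suc)
qed simp

end

section \<open>The Bailey chain\<close>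

lemma summable_on_times_real:
  fixes f :: "'a \<Rightarrow> real" and g :: "'b \<Rightarrow> real"
  assumes "f summable_on A" "g summable_on B" "\<And>x. f x \<ge> 0" "\<And>y. g y \<ge> 0"
  shows "(\<lambda>(x, y). f x * g y) summable_on A \<times> B"
proof (rule summable_on_SigmaI[where g = "\<lambda>x. f x * infsum g B"])
  show "((\<lambda>y. case (x, y) of (x, y) \<Rightarrow> f x * g y) has_sum f x * infsum g B) B" for x
    using has_sum_cmult_right[OF has_sum_infsum[OF assms(2)], of "f x"] by simp
  show "(\<lambda>x. f x * infsum g B) summable_on A"
    using assms(1) by (rule summable_on_cmult_left)
qed (use assms in auto)

lemma has_sum_times:
  fixes f :: "'a \<Rightarrow> 'c :: {real_normed_field, banach}" and g :: "'b \<Rightarrow> 'c"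
  assumes "(f has_sum a) A" "(g has_sum b) B"
    and "(\<lambda>x. norm (f x)) summable_on A" "(\<lambda>y. norm (g y)) summable_on B"
  shows "((\<lambda>(x, y). f x * g y) has_sum a * b) (A \<times> B)"
proof (rule has_sum_SigmaI[where g = "\<lambda>x. f x * b"])
  show "((\<lambda>y. case (x, y) of (x, y) \<Rightarrow> f x * g y) has_sum f x * b) B" for x
    using has_sum_cmult_right[OF assms(2), of "f x"] by simp
  show "((\<lambda>x. f x * b) has_sum a * b) A"
    using assms(1) by (rule has_sum_cmult_left)
  have "(\<lambda>(x, y). norm (f x) * norm (g y)) summable_on A \<times> B"
    using assms(3,4) by (rule summable_on_times_real) auto
  hence "(\<lambda>p. norm (case p of (x, y) \<Rightarrow> f x * g y)) summable_on A \<times> B"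
    by (simp add: case_prod_unfold norm_mult)
  thus "(\<lambda>(x, y). f x * g y) summable_on A \<times> B"
    by (rule abs_summable_summable)
qed

lemma convergent_prod_qpoch:
  fixes q x :: complex
  assumes "norm q < 1"
  shows "convergent_prod (\<lambda>j. 1 - x * q ^ j)"
proof (rule abs_convergent_prod_imp_convergent_prod, rule summable_imp_abs_convergent_prod)
  show "summable (\<lambda>j. norm (1 - x * q ^ j - 1))"
    using assms by (simp add: norm_mult norm_power summable_mult summable_geometric)
qed

lemma qpoch_tendsto:
  assumes "norm q < 1"
  shows "(\<lambda>n. qpoch x q n) \<longlonglongrightarrow> qpoch_inf x q"
proof -
  have "(\<lambda>n. qpoch x q (Suc n)) \<longlonglongrightarrow> qpoch_inf x q"
    using convergent_prod_LIMSEQ[OF convergent_prod_qpoch[OF assms]]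
    by (simp add: qpoch_def qpoch_inf_def lessThan_Suc_atMost)
  thus ?thesis by (simp only: filterlim_sequentially_Suc)
qed

text \<open>Forgetting the squares in the weight and the monotonicity of the tuples leaves a product
  of \<open>s\<close> geometric series. This is the majorant for every interchange of summations
  over tuples.\<close>

lemma summable_on_power_tuples:
  fixes x :: real
  assumes x: "0 \<le> x" "x < 1"
  shows "(\<lambda>n. x ^ tuple_weight s n) summable_on nondec_tuples s"
proof -
  have summable: "summable (\<lambda>k. x ^ k)"
    using x by (simp add: summable_geometric)
  have "(\<lambda>n. \<Prod>i=1..s. x ^ n i) summable_on ({1..s} \<rightarrow>\<^sub>E (UNIV :: nat set))"
  proof (rule nonneg_bdd_above_summable_on)
    show "bdd_above (sum (\<lambda>n. \<Prod>i=1..s. x ^ n i) ` {F. F \<subseteq> {1..s} \<rightarrow>\<^sub>E (UNIV :: nat set) \<and> finite F})"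
    proof (rule bdd_aboveI2)
      fix F :: "(nat \<Rightarrow> nat) set"
      assume F: "F \<in> {F. F \<subseteq> {1..s} \<rightarrow>\<^sub>E UNIV \<and> finite F}"
      define N where "N = (\<Sum>n\<in>F. \<Sum>i=1..s. n i)"
      have "n i \<le> N" if "n \<in> F" "i \<in> {1..s}" for n i
      proof -
        have "n i \<le> (\<Sum>i=1..s. n i)"
          using that by (intro member_le_sum) auto
        also have "\<dots> \<le> N"
          unfolding N_def using that F by (intro member_le_sum[where f = "\<lambda>n. \<Sum>i=1..s. n i"]) auto
        finally show ?thesis .
      qed
      \<comment> \<open>A finite set of tuples fits into a box, over which the sum of products is a
        product of partial geometric sums.\<close>
      with F have "F \<subseteq> {1..s} \<rightarrow>\<^sub>E {..N}"
        by (auto simp: PiE_iff)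
      hence "(\<Sum>n\<in>F. \<Prod>i=1..s. x ^ n i) \<le> (\<Sum>n\<in>{1..s} \<rightarrow>\<^sub>E {..N}. \<Prod>i=1..s. x ^ n i)"
        using x by (intro sum_mono2 finite_PiE prod_nonneg) auto
      also have "\<dots> = (\<Prod>i=1..s. \<Sum>k\<le>N. x ^ k)"
        by (rule prod_sum_PiE[symmetric]) auto
      also have "\<dots> \<le> (\<Prod>i=1..s. \<Sum>k. x ^ k)"
        using x by (intro prod_mono conjI sum_nonneg sum_le_suminf summable) auto
      finally show "(\<Sum>n\<in>F. \<Prod>i=1..s. x ^ n i) \<le> (\<Prod>i=1..s. \<Sum>k. x ^ k)" .
    qed
  qed (use x in \<open>auto intro: prod_nonneg\<close>)
  hence "(\<lambda>n. \<Prod>i=1..s. x ^ n i) summable_on nondec_tuples s"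
    by (rule summable_on_subset_banach) (auto simp: nondec_tuples_def)
  thus ?thesis
  proof (rule summable_on_comparison_test)
    show "x ^ tuple_weight s n \<le> (\<Prod>i=1..s. x ^ n i)" for n
    proof -
      have "x ^ tuple_weight s n \<le> x ^ (\<Sum>i=1..s. n i)"
        using x by (intro power_decreasing) (auto simp: tuple_weight_def)
      thus ?thesis by (simp add: power_sum)
    qed
  qed (use x in auto)
qed

lemma qpoch_inf_square:
  assumes "norm q < 1"
  shows "(1 - q) * qpoch_inf (q ^ 2) q = qpoch_inf q q"
proof (rule LIMSEQ_unique)
  show "(\<lambda>n. qpoch q q (Suc n)) \<longlonglongrightarrow> (1 - q) * qpoch_inf (q ^ 2) q"
    unfolding qpoch_square[symmetric] by (intro tendsto_intros qpoch_tendsto assms)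
  show "(\<lambda>n. qpoch q q (Suc n)) \<longlonglongrightarrow> qpoch_inf q q"
    using qpoch_tendsto[OF assms] by (rule LIMSEQ_Suc)
qed

text \<open>Up to the factor 1/(1-q), the coefficient of \<alpha>_r in \<beta>_n for a Bailey pair
  relative to a = q. It vanishes for n < r.\<close>

definition bailey_term :: "complex \<Rightarrow> nat \<Rightarrow> nat \<Rightarrow> complex" where
  "bailey_term q r n = rqfact q n r / qpoch q q (n + r + 1)"

definition chain_term :: "complex \<Rightarrow> nat \<Rightarrow> nat \<Rightarrow> (nat \<Rightarrow> nat) \<Rightarrow> complex" where
  "chain_term q s r n = q ^ tuple_weight s n / diff_prod q s n * bailey_term q r (n 1)"

text \<open>Each layer with a prescribed top entry is finite. All steps of the chain except the last
  are therefore finite identities, and only the sum over the top entry involves a limit.\<close>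

definition tuples_top :: "nat \<Rightarrow> nat \<Rightarrow> (nat \<Rightarrow> nat) set" where
  "tuples_top s L = {n \<in> nondec_tuples s. n s = L}"

lemma tuples_top_le: "n \<in> tuples_top s L \<Longrightarrow> i \<in> {1..s} \<Longrightarrow> n i \<le> L"
  using mono_onD[of "{1..s}" n i s] by (simp add: tuples_top_def nondec_tuples_def)

lemma finite_tuples_top [simp]: "finite (tuples_top s L)"
proof (rule finite_subset)
  show "tuples_top s L \<subseteq> {1..s} \<rightarrow>\<^sub>E {..L}"
  proof
    fix n assume n: "n \<in> tuples_top s L"
    hence "n \<in> {1..s} \<rightarrow>\<^sub>E UNIV"
      by (simp add: tuples_top_def nondec_tuples_def)
    thus "n \<in> {1..s} \<rightarrow>\<^sub>E {..L}"
      using tuples_top_le[OF n] by (auto simp: PiE_iff)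
  qed
qed (auto intro: finite_PiE)

lemma tuples_top_1: "tuples_top 1 L = {\<lambda>i\<in>{1}. L}"
proof (intro equalityI subsetI)
  fix n assume "n \<in> tuples_top 1 L"
  hence "n \<in> extensional {1}" "n 1 = L"
    by (simp_all add: tuples_top_def nondec_tuples_def PiE_iff)
  hence "n = (\<lambda>i\<in>{1}. L)"
    by (intro extensionalityI[of _ "{1}"]) auto
  thus "n \<in> {\<lambda>i\<in>{1}. L}" by simp
qed (simp add: tuples_top_def nondec_tuples_def mono_on_def)

text \<open>Stripping off the top entry \<open>L\<close> exposes the next entry \<open>M\<close>,
  the variable that one application of the Bailey lemma sums over.\<close>

lemma bij_betw_tuples_top_Suc:
  assumes "s \<ge> 1"
  shows "bij_betw (\<lambda>(M, n). n(Suc s := L)) (Sigma {..L} (tuples_top s)) (tuples_top (Suc s) L)"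
proof (rule bij_betwI[where g = "\<lambda>n. (n s, restrict n {1..s})"])
  show "(\<lambda>(M, n). n(Suc s := L)) \<in> Sigma {..L} (tuples_top s) \<rightarrow> tuples_top (Suc s) L"
  proof safe
    fix M n assume M: "M \<le> L" and n: "n \<in> tuples_top s M"
    have "n i \<le> L" if "i \<in> {1..s}" for i
      using tuples_top_le[OF n that] M by simp
    moreover have n': "mono_on {1..s} n" "n \<in> {1..s} \<rightarrow>\<^sub>E UNIV"
      using n by (simp_all add: tuples_top_def nondec_tuples_def)
    moreover have "n i \<le> n j" if "1 \<le> i" "i \<le> j" "j \<le> s" for i j
      using mono_onD[OF n'(1), of i j] that by simp
    ultimately have "mono_on {1..Suc s} (n(Suc s := L))"
      by (intro mono_onI) (auto simp: le_Suc_eq)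
    moreover have "n(Suc s := L) \<in> {1..Suc s} \<rightarrow>\<^sub>E UNIV"
      using n'(2) by (auto simp: PiE_iff extensional_def)
    ultimately show "n(Suc s := L) \<in> tuples_top (Suc s) L"
      by (simp add: tuples_top_def nondec_tuples_def)
  qed
  show "(\<lambda>n. (n s, restrict n {1..s})) \<in> tuples_top (Suc s) L \<rightarrow> Sigma {..L} (tuples_top s)"
  proof safe
    fix n assume n: "n \<in> tuples_top (Suc s) L"
    show "n s \<le> L"
      using tuples_top_le[OF n, of s] assms by simp
    show "restrict n {1..s} \<in> tuples_top s (n s)"
      using n assms by (auto simp: tuples_top_def nondec_tuples_def mono_on_def)
  qed
  show "(\<lambda>n. (n s, restrict n {1..s})) (case x of (M, n) \<Rightarrow> n(Suc s := L)) = x"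
    if xS: "x \<in> Sigma {..L} (tuples_top s)" for x
  proof -
    obtain M n where x: "x = (M, n)" and n: "n \<in> tuples_top s M"
      using xS by (cases x) auto
    have "n \<in> extensional {1..s}" and top: "n s = M"
      using n by (simp_all add: tuples_top_def nondec_tuples_def PiE_iff)
    hence "restrict (n(Suc s := L)) {1..s} = n"
      by (intro extensionalityI[of _ "{1..s}"] restrict_extensional) (simp_all add: restrict_def)
    moreover have "(n(Suc s := L)) s = M"
      using top by simp
    ultimately show ?thesis
      unfolding x prod.case by (simp only:)
  qed
  show "(case (n s, restrict n {1..s}) of (M, n) \<Rightarrow> n(Suc s := L)) = n"
    if "n \<in> tuples_top (Suc s) L" for n
  proof -
    have n: "n \<in> extensional {1..Suc s}" "n (Suc s) = L"
      using that by (simp_all add: tuples_top_def nondec_tuples_def PiE_iff)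
    have "(restrict n {1..s})(Suc s := L) = n"
      using n by (intro extensionalityI[of _ "{1..Suc s}"]) (auto simp: extensional_def)
    thus ?thesis by simp
  qed
qed

context
  fixes q :: complex
  assumes q: "norm q < 1"
begin

lemma qpoch_inf_nonzero: "qpoch_inf q q \<noteq> 0"
proof -
  have "1 - q * q ^ j \<noteq> 0" for j
    using power_neq_one[OF q, of j] by simp
  thus ?thesis
    unfolding qpoch_inf_def by (intro prodinf_nonzero convergent_prod_qpoch q)
qed

lemma recip_qpoch_tendsto: "(\<lambda>n. 1 / qpoch q q n) \<longlonglongrightarrow> 1 / qpoch_inf q q"
  using tendsto_divide[OF tendsto_const qpoch_tendsto[OF q] qpoch_inf_nonzero] .

lemma recip_qpoch_bounded:
  obtains C where "C \<ge> 1" "\<And>n. norm (1 / qpoch q q n) \<le> C"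
proof -
  have "Bseq (\<lambda>n. 1 / qpoch q q n)"
    using recip_qpoch_tendsto convergentI convergent_imp_Bseq by blast
  then obtain C where C: "\<And>n. norm (1 / qpoch q q n) \<le> C"
    by (auto simp: Bseq_def)
  from C[of 0] have "C \<ge> 1" by simp
  with C show ?thesis by (intro that)
qed

lemma rqfact_tendsto: "(\<lambda>n. rqfact q n r) \<longlonglongrightarrow> 1 / qpoch_inf q q"
proof (rule LIMSEQ_offset[of _ r])
  show "(\<lambda>n. rqfact q (n + r) r) \<longlonglongrightarrow> 1 / qpoch_inf q q"
    using recip_qpoch_tendsto by (simp add: rqfact_def)
qed

text \<open>The Bailey lemma at a = q with both free parameters sent to infinity, read off for a
  single coefficient r. The substitution M = r + j turns it into \<open>bailey_finite\<close> with N
  = L - r and c = 2r + 1.\<close>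

lemma bailey_lemma:
  "(\<Sum>M\<le>L. rqfact q L M * (q ^ (M ^ 2 + M) * bailey_term q r M)) = q ^ (r ^ 2 + r) * bailey_term q r L"
proof (cases "r \<le> L")
  case True
  have "(\<Sum>M\<le>L. rqfact q L M * (q ^ (M ^ 2 + M) * bailey_term q r M))
      = (\<Sum>M\<in>{r..L}. rqfact q L M * (q ^ (M ^ 2 + M) * bailey_term q r M))"
    by (intro sum.mono_neutral_right) (auto simp: bailey_term_def)
  also have "\<dots> = (\<Sum>j\<le>L - r. q ^ (r ^ 2 + r) * (q ^ (j ^ 2 + (2 * r + 1) * j)
      / (qpoch q q j * qpoch q q ((L - r) - j) * qpoch q q (j + (2 * r + 1)))))"
  proof (rule sum.reindex_bij_witness[where i = "\<lambda>j. r + j" and j = "\<lambda>M. M - r"])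
    fix M assume M: "M \<in> {r..L}"
    then obtain j where j: "M = r + j"
      using le_Suc_ex by auto
    have "M ^ 2 + M = (r ^ 2 + r) + (j ^ 2 + (2 * r + 1) * j)"
      unfolding j by (simp add: power2_eq_square algebra_simps)
    hence pow: "q ^ (M ^ 2 + M) = q ^ (r ^ 2 + r) * q ^ (j ^ 2 + (2 * r + 1) * j)"
      by (simp only: power_add)
    have eqs: "M + r + 1 = j + (2 * r + 1)" "L - M = (L - r) - j" "M - r = j"
      using j by auto
    show "q ^ (r ^ 2 + r) * (q ^ ((M - r) ^ 2 + (2 * r + 1) * (M - r))
      / (qpoch q q (M - r) * qpoch q q ((L - r) - (M - r)) * qpoch q q ((M - r) + (2 * r + 1))))
      = rqfact q L M * (q ^ (M ^ 2 + M) * bailey_term q r M)"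
      using M unfolding pow bailey_term_def rqfact_def eqs by (simp add: mult_ac)
  qed (use True in auto)
  also have "\<dots> = q ^ (r ^ 2 + r) * (1 / (qpoch q q (L - r) * qpoch q q (L - r + (2 * r + 1))))"
    unfolding sum_distrib_left[symmetric] bailey_finite[OF q] ..
  also have "L - r + (2 * r + 1) = L + r + 1"
    using True by simp
  finally show ?thesis
    using True by (simp add: bailey_term_def rqfact_def)
qed (auto simp: bailey_term_def intro!: sum.neutral)

lemma bailey_term_bounded:
  obtains C where "C \<ge> 1" "\<And>n. norm (1 / qpoch q q n) \<le> C" "\<And>n r. norm (rqfact q n r) \<le> C"
    "\<And>n r. norm (bailey_term q r n) \<le> C * C"
proof -
  obtain C where C: "C \<ge> 1" "\<And>n. norm (1 / qpoch q q n) \<le> C"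
    by (rule recip_qpoch_bounded) blast
  have rq: "norm (rqfact q n r) \<le> C" for n r
    unfolding rqfact_def using C(1) C(2)[of "n - r"] by auto
  have "norm (bailey_term q r n) \<le> C * C" for n r
  proof -
    have "norm (bailey_term q r n) = norm (rqfact q n r) * norm (1 / qpoch q q (n + r + 1))"
      by (simp add: bailey_term_def norm_divide)
    also have "\<dots> \<le> C * C"
      using C(1) by (intro mult_mono rq C) auto
    finally show ?thesis .
  qed
  with C rq show ?thesis by (rule that)
qed

text \<open>Let L tend to infinity in \<open>bailey_lemma\<close>, with Tannery's theorem on the
  left. The left side acquires one factor 1/(q;q)_\<infinity> and the right side two, so one of them
  cancels.\<close>

lemma bailey_lemma_inf:
  "((\<lambda>M. q ^ (M ^ 2 + M) * bailey_term q r M) has_sum q ^ (r ^ 2 + r) / qpoch_inf q q) UNIV"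
proof -
  obtain C where C: "C \<ge> 1" "\<And>n. norm (1 / qpoch q q n) \<le> C" "\<And>n r. norm (rqfact q n r) \<le> C"
    "\<And>n r. norm (bailey_term q r n) \<le> C * C"
    by (rule bailey_term_bounded) blast
  let ?b = "\<lambda>M. q ^ (M ^ 2 + M) * bailey_term q r M"
  let ?P = "1 / qpoch_inf q q"
  have b: "norm (?b M) \<le> norm q ^ M * (C * C)" for M
    unfolding norm_mult norm_power using q C(1)
    by (intro mult_mono C power_decreasing) auto
  have "eventually (\<lambda>L. summable (\<lambda>M. norm (rqfact q L M * ?b M))) sequentially \<and>
     summable (\<lambda>M. norm (?P * ?b M)) \<and>
     (\<lambda>L. \<Sum>M. rqfact q L M * ?b M) \<longlonglongrightarrow> (\<Sum>M. ?P * ?b M)"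
  proof (rule tannerys_theorem)
    show "(\<lambda>L. rqfact q L M * ?b M) \<longlonglongrightarrow> ?P * ?b M" for M
      by (intro tendsto_intros rqfact_tendsto)
    show "\<forall>\<^sub>F (M, L) in sequentially \<times>\<^sub>F sequentially.
        norm (rqfact q L M * ?b M) \<le> C * (norm q ^ M * (C * C))"
      unfolding norm_mult[of "rqfact _ _ _"] case_prod_beta using C(1)
      by (intro always_eventually allI mult_mono C b) auto
    show "summable (\<lambda>M. C * (norm q ^ M * (C * C)))"
      using q by (intro summable_mult summable_mult2 summable_geometric) auto
  qed auto
  moreover have "(\<Sum>M. rqfact q L M * ?b M) = q ^ (r ^ 2 + r) * bailey_term q r L" for L
    by (subst suminf_finite[of "{..L}"]) (auto simp: bailey_lemma)
  ultimately have lim: "(\<lambda>L. q ^ (r ^ 2 + r) * bailey_term q r L) \<longlonglongrightarrow> (\<Sum>M. ?P * ?b M)"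
    by simp
  have "(\<lambda>L. q ^ (r ^ 2 + r) * (rqfact q L r * (1 / qpoch q q (L + (r + 1)))))
      \<longlonglongrightarrow> q ^ (r ^ 2 + r) * (?P * ?P)"
    by (intro tendsto_intros rqfact_tendsto LIMSEQ_ignore_initial_segment[OF recip_qpoch_tendsto])
  hence eq: "(\<Sum>M. ?P * ?b M) = q ^ (r ^ 2 + r) * (?P * ?P)"
    using LIMSEQ_unique[OF lim] by (simp add: bailey_term_def)
  have summable: "summable (\<lambda>M. norm (?b M))"
  proof (rule summable_comparison_test')
    show "summable (\<lambda>M. norm q ^ M * (C * C))"
      using q by (intro summable_mult2 summable_geometric) auto
  qed (use b in auto)
  have "?P * (\<Sum>M. ?b M) = q ^ (r ^ 2 + r) * (?P * ?P)"
    using eq unfolding suminf_mult[OF summable_norm_cancel[OF summable]] .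
  hence "(\<Sum>M. ?b M) = q ^ (r ^ 2 + r) / qpoch_inf q q"
    using qpoch_inf_nonzero by (simp add: field_simps)
  thus ?thesis
    using norm_summable_imp_has_sum[OF summable summable_sums[OF summable_norm_cancel[OF summable]]]
    by simp
qed

text \<open>A new top entry contributes q^(L^2+L) and 1/(q;q)_(L-M), exactly the ingredients of
  \<open>bailey_lemma\<close> in M, so each level multiplies by q^(r^2+r). The exponent is
  \<open>s - 1\<close> because the weight of the top entry has not yet been summed.\<close>

lemma sum_chain_term_top:
  assumes "s \<ge> 1"
  shows "(\<Sum>n\<in>tuples_top s L. chain_term q s r n)
     = q ^ (L ^ 2 + L) * (q ^ ((s - 1) * (r ^ 2 + r)) * bailey_term q r L)"
  using assms
proof (induction s arbitrary: L rule: dec_induct)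
  case base
  show ?case
    by (simp add: tuples_top_1[unfolded One_nat_def] chain_term_def diff_prod_def tuple_weight_def)
next
  case (step s)
  let ?c = "q ^ ((s - 1) * (r ^ 2 + r))"
  have "(\<Sum>n\<in>tuples_top (Suc s) L. chain_term q (Suc s) r n)
      = (\<Sum>(M, n)\<in>Sigma {..L} (tuples_top s). chain_term q (Suc s) r (n(Suc s := L)))"
    using sum.reindex_bij_betw[OF bij_betw_tuples_top_Suc[OF step.hyps(1)], symmetric]
    by (simp add: case_prod_unfold)
  also have "\<dots> = (\<Sum>M\<le>L. \<Sum>n\<in>tuples_top s M. chain_term q (Suc s) r (n(Suc s := L)))"
    by (rule sum.Sigma[symmetric]) auto
  also have "\<dots> = (\<Sum>M\<le>L. q ^ (L ^ 2 + L) * (?c * (rqfact q L M * (q ^ (M ^ 2 + M) * bailey_term q r M))))"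
  proof (intro sum.cong refl)
    fix M assume M: "M \<in> {..L}"
    have "chain_term q (Suc s) r (n(Suc s := L)) = q ^ (L ^ 2 + L) * rqfact q L M * chain_term q s r n"
      if n: "n \<in> tuples_top s M" for n
    proof -
      have "tuple_weight (Suc s) (n(Suc s := L)) = (L ^ 2 + L) + tuple_weight s n"
        by (simp add: tuple_weight_def)
      moreover have "(\<Prod>i=2..s. qpoch q q ((n(Suc s := L)) i - (n(Suc s := L)) (i - 1))) = diff_prod q s n"
        unfolding diff_prod_def by (intro prod.cong) auto
      hence "diff_prod q (Suc s) (n(Suc s := L)) = diff_prod q s n * qpoch q q (L - M)"
        using step.hyps n by (simp add: diff_prod_def tuples_top_def)
      ultimately show ?thesis
        using step.hyps M by (simp add: chain_term_def power_add rqfact_def mult_ac)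
    qed
    hence "(\<Sum>n\<in>tuples_top s M. chain_term q (Suc s) r (n(Suc s := L)))
        = q ^ (L ^ 2 + L) * rqfact q L M * (\<Sum>n\<in>tuples_top s M. chain_term q s r n)"
      by (simp add: sum_distrib_left)
    thus "(\<Sum>n\<in>tuples_top s M. chain_term q (Suc s) r (n(Suc s := L)))
        = q ^ (L ^ 2 + L) * (?c * (rqfact q L M * (q ^ (M ^ 2 + M) * bailey_term q r M)))"
      unfolding step.IH by (simp add: mult_ac)
  qed
  also have "\<dots> = q ^ (L ^ 2 + L) * (?c * (q ^ (r ^ 2 + r) * bailey_term q r L))"
    unfolding sum_distrib_left[symmetric] bailey_lemma ..
  also have "?c * (q ^ (r ^ 2 + r) * bailey_term q r L) = q ^ (s * (r ^ 2 + r)) * bailey_term q r L"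
    using step.hyps by (cases s) (simp_all add: power_add mult_ac)
  finally show ?case by simp
qed

text \<open>\<open>K\<close> does not depend on \<open>r\<close>; this uniformity is what later
  permits the exchange of the r-sum with the tuple sums.\<close>

lemma chain_term_bound:
  obtains K where "K \<ge> 0" "\<And>r n. norm (chain_term q s r n) \<le> K * norm q ^ tuple_weight s n"
proof -
  obtain C where C: "C \<ge> 1" "\<And>n. norm (1 / qpoch q q n) \<le> C" "\<And>n r. norm (rqfact q n r) \<le> C"
    "\<And>n r. norm (bailey_term q r n) \<le> C * C"
    by (rule bailey_term_bounded) blast
  show ?thesis
  proof (rule that[of "C ^ card {2..s} * (C * C)"])
    fix r n
    have "norm (1 / diff_prod q s n) = (\<Prod>i=2..s. norm (1 / qpoch q q (n i - n (i - 1))))"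
      by (simp add: diff_prod_def norm_divide prod_norm prod_dividef)
    also have "\<dots> \<le> (\<Prod>i=2..s. C)"
      by (intro prod_mono conjI C) auto
    finally have "norm (1 / diff_prod q s n) \<le> C ^ card {2..s}" by simp
    hence "norm (1 / diff_prod q s n) * norm (bailey_term q r (n 1)) \<le> C ^ card {2..s} * (C * C)"
      using C(1) by (intro mult_mono C) auto
    moreover have "norm (chain_term q s r n) = norm (1 / diff_prod q s n) * norm (bailey_term q r (n 1))
        * norm q ^ tuple_weight s n"
      by (simp add: chain_term_def norm_mult norm_divide norm_power)
    ultimately show "norm (chain_term q s r n) \<le> C ^ card {2..s} * (C * C) * norm q ^ tuple_weight s n"
      by (simp add: mult_right_mono)
  qed (use C in auto)
qed

lemma chain_term_abs_summable: "(\<lambda>n. norm (chain_term q s r n)) summable_on nondec_tuples s"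
proof -
  obtain K where K: "\<And>r n. norm (chain_term q s r n) \<le> K * norm q ^ tuple_weight s n"
    by (rule chain_term_bound) blast
  show ?thesis
  proof (rule Infinite_Sum.abs_summable_on_comparison_test')
    show "(\<lambda>n. K * norm q ^ tuple_weight s n) summable_on nondec_tuples s"
      using q by (intro summable_on_cmult_right summable_on_power_tuples) auto
  qed (rule K)
qed

text \<open>Fibring the tuples over their top entry gives finite inner sums, known from
  \<open>sum_chain_term_top\<close>. The outer sum is \<open>bailey_lemma_inf\<close>, which
  supplies the last factor q^(r^2+r).\<close>

lemma chain_term_has_sum:
  assumes "s \<ge> 1"
  shows "(chain_term q s r has_sum q ^ (s * (r ^ 2 + r)) / qpoch_inf q q) (nondec_tuples s)"
proof -
  obtain S where S: "(chain_term q s r has_sum S) (nondec_tuples s)"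
    using abs_summable_summable[OF chain_term_abs_summable] by (auto simp: summable_on_def)
  have "bij_betw snd (Sigma UNIV (tuples_top s)) (nondec_tuples s)"
    by (rule bij_betwI[where g = "\<lambda>n. (n s, n)"]) (auto simp: tuples_top_def)
  with S have "((\<lambda>p. chain_term q s r (snd p)) has_sum S) (Sigma UNIV (tuples_top s))"
    by (simp add: has_sum_reindex_bij_betw)
  hence "((\<lambda>L. q ^ (L ^ 2 + L) * (q ^ ((s - 1) * (r ^ 2 + r)) * bailey_term q r L)) has_sum S) UNIV"
    by (rule has_sum_SigmaD) (simp add: has_sum_finite_iff sum_chain_term_top[OF assms])
  moreover have "((\<lambda>L. q ^ ((s - 1) * (r ^ 2 + r)) * (q ^ (L ^ 2 + L) * bailey_term q r L)) has_sum
      q ^ ((s - 1) * (r ^ 2 + r)) * (q ^ (r ^ 2 + r) / qpoch_inf q q)) UNIV"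
    by (intro has_sum_cmult_right bailey_lemma_inf)
  ultimately have "S = q ^ ((s - 1) * (r ^ 2 + r)) * (q ^ (r ^ 2 + r) / qpoch_inf q q)"
    by (intro has_sum_unique) (simp_all add: mult_ac)
  also have "\<dots> = q ^ (s * (r ^ 2 + r)) / qpoch_inf q q"
    using assms by (cases s) (simp_all add: power_add mult_ac)
  finally show ?thesis using S by simp
qed

end

section \<open>The Jacobi triple product\<close>

lemma add_choose_two: "(a + b) choose 2 = (a choose 2) + (b choose 2) + a * b"
  by (induction b) (simp_all add: numeral_2_eq_2)

lemma mult_self_choose_two: "n * n = n + 2 * (n choose 2)"
  by (induction n) (simp_all add: numeral_2_eq_2)

definition gauss_binom :: "complex \<Rightarrow> nat \<Rightarrow> nat \<Rightarrow> complex" where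
  "gauss_binom w m k = qpoch w w m * rqfact w m k / qpoch w w k"

text \<open>The q-Pascal rule, from 1 - w^(m+1) = (1 - w^(m-k)) + w^(m-k) (1 - w^(k+1)) over the
  common denominator.\<close>

lemma gauss_binom_Suc_Suc:
  assumes "norm w < 1" "k \<le> m"
  shows "gauss_binom w (Suc m) (Suc k) = gauss_binom w m (Suc k) + w ^ (m - k) * gauss_binom w m k"
proof -
  have "w ^ (m - k) * w ^ Suc k = w ^ Suc m"
    using assms(2) by (simp add: power_add[symmetric] del: power_Suc)
  hence "1 - w ^ Suc m = (1 - w ^ (m - k)) + w ^ (m - k) * (1 - w ^ Suc k)"
    by (simp add: algebra_simps del: power_Suc)
  moreover have "gauss_binom w m k = qpoch w w m * rqfact w m k * (1 - w ^ Suc k) / qpoch w w (Suc k)"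
    by (simp add: gauss_binom_def divide_inverse recip_qpoch_Suc[OF assms(1), of k] del: power_Suc)
  moreover have "gauss_binom w m (Suc k)
      = qpoch w w m * ((1 - w ^ (m - k)) * rqfact w m k) / qpoch w w (Suc k)"
    by (simp add: gauss_binom_def rqfact_Suc_right[OF assms(1)])
  moreover have "gauss_binom w (Suc m) (Suc k)
      = qpoch w w m * (1 - w ^ Suc m) * rqfact w m k / qpoch w w (Suc k)"
    by (simp add: gauss_binom_def qpoch_self_Suc[of w m])
  ultimately show ?thesis
    by (simp add: add_divide_distrib[symmetric] algebra_simps del: power_Suc)
qed

lemma q_binomial_theorem:
  assumes "norm w < 1"
  shows "(\<Prod>i<m. u + y * w ^ i)
    = (\<Sum>k\<le>m. gauss_binom w m k * w ^ (k choose 2) * y ^ k * u ^ (m - k))"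
proof (induction m)
  case 0
  show ?case by (simp add: gauss_binom_def rqfact_def numeral_2_eq_2)
next
  case (Suc m)
  let ?t = "\<lambda>m k. gauss_binom w m k * w ^ (k choose 2) * y ^ k * u ^ (m - k)"
  have t0: "?t (Suc m) 0 = u * ?t m 0"
    using qpoch_nonzero[OF assms] by (simp add: gauss_binom_def rqfact_def)
  have t: "?t (Suc m) (Suc k) = u * ?t m (Suc k) + y * w ^ m * ?t m k" if "k \<le> m" for k
  proof -
    have e1: "w ^ (m - k) * w ^ (Suc k choose 2) = w ^ m * w ^ (k choose 2)"
      using that by (simp add: numeral_2_eq_2 power_add[symmetric])
    \<comment> \<open>At k = m the subtraction in \<open>m - Suc k\<close> truncates, and the
      identity holds only because \<open>gauss_binom w m (Suc m)\<close> is 0.\<close>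
    have e2: "gauss_binom w m (Suc k) * u ^ (m - k) = u * (gauss_binom w m (Suc k) * u ^ (m - Suc k))"
    proof (cases "k = m")
      case False
      hence "m - k = Suc (m - Suc k)"
        using that by simp
      thus ?thesis by simp
    qed (simp add: gauss_binom_def)
    have e3: "?t (Suc m) (Suc k) = (gauss_binom w m (Suc k) * u ^ (m - k)) * w ^ (Suc k choose 2) * y ^ Suc k
        + gauss_binom w m k * (w ^ (m - k) * w ^ (Suc k choose 2)) * y ^ Suc k * u ^ (m - k)"
      unfolding gauss_binom_Suc_Suc[OF assms that] by (simp add: algebra_simps)
    show ?thesis
      unfolding e3 e1 e2 by (simp add: algebra_simps)
  qed
  have "(\<Sum>k\<le>Suc m. ?t (Suc m) k) = u * ?t m 0 + (\<Sum>k\<le>m. u * ?t m (Suc k) + y * w ^ m * ?t m k)"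
    unfolding sum.atMost_Suc_shift t0 by (intro arg_cong2[where f = "(+)"] sum.cong refl t) auto
  also have "\<dots> = u * (\<Sum>k\<le>Suc m. ?t m k) + y * w ^ m * (\<Sum>k\<le>m. ?t m k)"
    unfolding sum.atMost_Suc_shift[of "?t m"] by (simp add: sum.distrib sum_distrib_left distrib_left)
  also have "(\<Sum>k\<le>Suc m. ?t m k) = (\<Sum>k\<le>m. ?t m k)"
    by (simp add: gauss_binom_def)
  finally show ?case
    unfolding prod.lessThan_Suc Suc.IH by (simp add: algebra_simps)
qed

lemma prod_lessThan_add: "(\<Prod>i<a + b. f i) = (\<Prod>i<a. f i) * (\<Prod>i<b. f (a + i))"
  for f :: "nat \<Rightarrow> 'a :: comm_monoid_mult"
  by (induction b) (simp_all add: mult.assoc)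

lemma sum_lessThan_add: "(\<Sum>i<a + b. f i) = (\<Sum>i<a. f i) + (\<Sum>i<b. f (a + i))"
  for f :: "nat \<Rightarrow> 'a :: comm_monoid_add"
  by (induction b) (simp_all add: add.assoc)

text \<open>The bilateral series with terms (-1)^m z^m w^(m(m-1)/2), folded: the indices m = -j and
  m = j+1 carry the same power of w.\<close>

definition theta_term :: "complex \<Rightarrow> complex \<Rightarrow> nat \<Rightarrow> complex" where
  "theta_term w z j = (-1) ^ j * w ^ (Suc j choose 2) * (1 / z ^ j - z ^ Suc j)"

text \<open>The q-binomial theorem with 2n+1 factors, u = w^n and y = -z. The first n factors, in
  reverse order, give (w/z;w)_n, and the other n+1 give (z;w)_(n+1). On the sum side the indices n-j
  and n+1+j add up to 2n+1, so they share a Gaussian binomial and pair up to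
  \<open>theta_term\<close>.\<close>

lemma jacobi_triple_finite:
  assumes w: "norm w < 1" "w \<noteq> 0" and z: "z \<noteq> 0"
  shows "qpoch w w (2 * n + 1) * (\<Sum>j\<le>n. theta_term w z j * bailey_term w j n)
    = qpoch z w (n + 1) * qpoch (w / z) w n"
proof -
  \<comment> \<open>The monomial common to both sides: (-z)^n w^(n choose 2) comes from the first n
    factors of the product and (w^n)^(n+1) from the remaining ones.\<close>
  define c where "c = (- z) ^ n * w ^ ((n choose 2) + n * (n + 1))"
  have "c \<noteq> 0"
    using w z by (simp add: c_def)
  let ?m = "2 * n + 1"
  let ?t = "\<lambda>k. gauss_binom w ?m k * w ^ (k choose 2) * (- z) ^ k * (w ^ n) ^ (?m - k)"
  have "(\<Prod>i<?m. w ^ n + (- z) * w ^ i)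
      = (\<Prod>i<n. w ^ n + (- z) * w ^ i) * (\<Prod>i<n + 1. w ^ n + (- z) * w ^ (n + i))"
    unfolding mult_2 add.assoc by (rule prod_lessThan_add)
  also have "(\<Prod>i<k. w ^ n + (- z) * w ^ (n + i)) = (w ^ n) ^ k * qpoch z w k" for k
    by (induction k) (simp_all add: qpoch_Suc power_add algebra_simps)
  also have "(\<Prod>i<n. w ^ n + (- z) * w ^ i) = (\<Prod>i<n. w ^ n + (- z) * w ^ (n - Suc i))"
    by (rule prod.nat_diff_reindex[symmetric])
  also have "\<dots> = (\<Prod>i<n. ((- z) * w ^ (n - Suc i)) * (1 - w / z * w ^ i))"
  proof (intro prod.cong refl)
    fix i assume "i \<in> {..<n}"
    hence "w ^ n = w ^ (n - Suc i) * (w * w ^ i)"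
      by (simp add: power_add[symmetric] flip: power_Suc)
    thus "w ^ n + (- z) * w ^ (n - Suc i) = ((- z) * w ^ (n - Suc i)) * (1 - w / z * w ^ i)"
      using z by (simp add: algebra_simps)
  qed
  also have "\<dots> = (\<Prod>i<n. (- z) * w ^ (n - Suc i)) * qpoch (w / z) w n"
    by (simp only: prod.distrib qpoch_def)
  also have "(\<Prod>i<n. (- z) * w ^ (n - Suc i)) = (\<Prod>i<n. (- z) * w ^ i)"
    by (rule prod.nat_diff_reindex)
  also have "(\<Prod>i<k. (- z) * w ^ i) = (- z) ^ k * w ^ (k choose 2)" for k
    by (induction k) (simp_all add: numeral_2_eq_2 power_add)
  finally have lhs: "(\<Prod>i<?m. w ^ n + (- z) * w ^ i) = c * (qpoch z w (n + 1) * qpoch (w / z) w n)"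
    by (simp add: c_def power_add power_mult mult_ac)
  have "(\<Sum>k\<le>?m. ?t k) = (\<Sum>k<(n + 1) + (n + 1). ?t k)"
    unfolding lessThan_Suc_atMost[symmetric] by (simp add: mult_2)
  also have "\<dots> = (\<Sum>k<n + 1. ?t k) + (\<Sum>j<n + 1. ?t (n + 1 + j))"
    by (rule sum_lessThan_add)
  also have "(\<Sum>k<n + 1. ?t k) = (\<Sum>j<n + 1. ?t (n + 1 - Suc j))"
    by (rule sum.nat_diff_reindex[symmetric])
  also have "(\<Sum>j<n + 1. ?t (n + 1 - Suc j)) + (\<Sum>j<n + 1. ?t (n + 1 + j))
      = (\<Sum>j<n + 1. ?t (n - j) + ?t (n + 1 + j))"
    by (simp only: sum.distrib diff_Suc_Suc Suc_eq_plus1[symmetric])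
  also have "\<dots> = (\<Sum>j<n + 1. c * (qpoch w w ?m * (theta_term w z j * bailey_term w j n)))"
  proof (intro sum.cong refl)
    fix j assume "j \<in> {..<n + 1}"
    then obtain d where d: "n = j + d"
      using le_Suc_ex[of j n] by auto
    define b where "b = qpoch w w ?m * bailey_term w j n"
    have g: "gauss_binom w ?m (n - j) = b" "gauss_binom w ?m (n + 1 + j) = b"
    proof -
      have "?m - (n - j) = n + j + 1" "?m - (n + 1 + j) = n - j"
        "n - j \<le> ?m" "n + 1 + j \<le> ?m" "j \<le> n" "n + 1 + j = n + j + 1"
        unfolding d by simp_all
      thus "gauss_binom w ?m (n - j) = b" "gauss_binom w ?m (n + 1 + j) = b"
        unfolding b_def gauss_binom_def bailey_term_def rqfact_def by (simp_all only: if_True) simp_all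
    qed
    have e1: "((n - j) choose 2) + n * (?m - (n - j)) = ((n choose 2) + n * (n + 1)) + (Suc j choose 2)"
      unfolding d add_choose_two[of j d] using mult_self_choose_two[of j]
      by (simp add: numeral_2_eq_2 algebra_simps)
    have e2: "((n + 1 + j) choose 2) + n * (?m - (n + 1 + j)) = ((n choose 2) + n * (n + 1)) + (Suc j choose 2)"
    proof -
      have "n + 1 + j = n + Suc j" by simp
      thus ?thesis
        unfolding add_choose_two[of n "Suc j"] \<open>n + 1 + j = n + Suc j\<close> by (simp add: d algebra_simps)
    qed
    have z1: "(- z) ^ (n - j) = (- z) ^ n * ((-1) ^ j * (1 / z ^ j))"
      using z by (simp add: d power_add power_minus[of z])
    have z2: "(- z) ^ (n + 1 + j) = (- z) ^ n * ((-1) ^ j * (- (z ^ Suc j)))"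
      by (simp add: power_add power_minus[of z])
    have t1: "?t (n - j) = b * w ^ (((n - j) choose 2) + n * (?m - (n - j))) * (- z) ^ (n - j)"
      unfolding g by (simp add: power_add power_mult mult_ac)
    have t2: "?t (n + 1 + j)
        = b * w ^ (((n + 1 + j) choose 2) + n * (?m - (n + 1 + j))) * (- z) ^ (n + 1 + j)"
      unfolding g by (simp only: power_add power_mult mult_ac)
    show "?t (n - j) + ?t (n + 1 + j) = c * (qpoch w w ?m * (theta_term w z j * bailey_term w j n))"
      unfolding t1 t2 unfolding e1 e2 z1 z2 c_def theta_term_def b_def power_add[of w _ "Suc j choose 2"]
      by (simp add: algebra_simps)
  qed
  also have "\<dots> = c * (qpoch w w ?m * (\<Sum>j\<le>n. theta_term w z j * bailey_term w j n))"
    by (simp only: sum_distrib_left lessThan_Suc_atMost Suc_eq_plus1[symmetric])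
  finally show ?thesis
    using q_binomial_theorem[OF w(1), of "w ^ n" "- z" ?m] \<open>c \<noteq> 0\<close> unfolding lhs by simp
qed

text \<open>Let n tend to infinity in the finite form. The weights \<open>bailey_term w j n\<close>
  are bounded uniformly and tend to 1/(w;w)_\<infinity>^2, so summability of the theta terms
  suffices for Tannery's theorem.\<close>

lemma jacobi_triple_product:
  assumes w: "norm w < 1" "w \<noteq> 0" and z: "z \<noteq> 0" and "summable (\<lambda>j. norm (theta_term w z j))"
  shows "(\<Sum>j. theta_term w z j) = qpoch_inf w w * qpoch_inf z w * qpoch_inf (w / z) w"
proof -
  obtain C where C: "C \<ge> 1" "\<And>n r. norm (bailey_term w r n) \<le> C * C"
    by (rule bailey_term_bounded[OF w(1)]) blast
  let ?P = "qpoch_inf w w"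
  have nz: "?P \<noteq> 0"
    by (rule qpoch_inf_nonzero[OF w(1)])
  have bt: "(\<lambda>n. bailey_term w j n) \<longlonglongrightarrow> 1 / ?P * (1 / ?P)" for j
    using tendsto_mult[OF rqfact_tendsto[OF w(1), of j]
        LIMSEQ_ignore_initial_segment[OF recip_qpoch_tendsto[OF w(1)], of "j + 1"]]
    by (simp add: bailey_term_def)
  have "eventually (\<lambda>n. summable (\<lambda>j. norm (theta_term w z j * bailey_term w j n))) sequentially \<and>
     summable (\<lambda>j. norm (theta_term w z j * (1 / ?P * (1 / ?P)))) \<and>
     (\<lambda>n. \<Sum>j. theta_term w z j * bailey_term w j n) \<longlonglongrightarrow> (\<Sum>j. theta_term w z j * (1 / ?P * (1 / ?P)))"
  proof (rule tannerys_theorem)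
    show "(\<lambda>n. theta_term w z j * bailey_term w j n) \<longlonglongrightarrow> theta_term w z j * (1 / ?P * (1 / ?P))" for j
      by (intro tendsto_intros bt)
    show "\<forall>\<^sub>F (j, n) in sequentially \<times>\<^sub>F sequentially.
        norm (theta_term w z j * bailey_term w j n) \<le> norm (theta_term w z j) * (C * C)"
      unfolding norm_mult case_prod_beta
      by (intro always_eventually allI mult_left_mono C) auto
    show "summable (\<lambda>j. norm (theta_term w z j) * (C * C))"
      using assms(4) by (rule summable_mult2)
  qed auto
  moreover have "(\<Sum>j. theta_term w z j * bailey_term w j n) = (\<Sum>j\<le>n. theta_term w z j * bailey_term w j n)" for n
    by (intro suminf_finite) (auto simp: bailey_term_def)
  ultimately have "(\<lambda>n. \<Sum>j\<le>n. theta_term w z j * bailey_term w j n)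
      \<longlonglongrightarrow> (\<Sum>j. theta_term w z j * (1 / ?P * (1 / ?P)))"
    by simp
  moreover have "(\<lambda>n. qpoch w w (2 * n + 1)) \<longlonglongrightarrow> ?P"
    using LIMSEQ_subseq_LIMSEQ[OF qpoch_tendsto[OF w(1)], of "\<lambda>n. 2 * n + 1"]
    by (simp add: strict_mono_def o_def)
  ultimately have "(\<lambda>n. qpoch w w (2 * n + 1) * (\<Sum>j\<le>n. theta_term w z j * bailey_term w j n))
      \<longlonglongrightarrow> ?P * (\<Sum>j. theta_term w z j * (1 / ?P * (1 / ?P)))"
    by (intro tendsto_mult)
  moreover have "(\<lambda>n. qpoch z w (n + 1) * qpoch (w / z) w n) \<longlonglongrightarrow> qpoch_inf z w * qpoch_inf (w / z) w"
    by (intro tendsto_mult qpoch_tendsto LIMSEQ_ignore_initial_segment w)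
  ultimately have "?P * (\<Sum>j. theta_term w z j * (1 / ?P * (1 / ?P))) = qpoch_inf z w * qpoch_inf (w / z) w"
    unfolding jacobi_triple_finite[OF w z] by (rule LIMSEQ_unique)
  also have "(\<Sum>j. theta_term w z j * (1 / ?P * (1 / ?P))) = (\<Sum>j. theta_term w z j) * (1 / ?P * (1 / ?P))"
    by (rule suminf_mult2[OF summable_norm_cancel[OF assms(4)], symmetric])
  finally show ?thesis
    using nz by (simp add: field_simps)
qed

section \<open>The theta series at argument q, and its product over residue classes\<close>

lemma theta_series:
  fixes q :: complex
  assumes q: "norm q < 1" and M: "M \<ge> 2"
  shows "((\<lambda>j. (-1) ^ j * q ^ (M * (Suc j choose 2) - j) * (1 - q ^ (2 * j + 1))) has_sum
    qpoch_inf (q ^ M) (q ^ M) * qpoch_inf q (q ^ M) * qpoch_inf (q ^ (M - 1)) (q ^ M)) UNIV"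
proof -
  let ?f = "\<lambda>j. (-1) ^ j * q ^ (M * (Suc j choose 2) - j) * (1 - q ^ (2 * j + 1))"
  \<comment> \<open>This makes the subtraction of \<open>j\<close> in the exponent exact and leaves
    an exponent of at least \<open>j\<close>, whence the geometric majorant.\<close>
  have ge: "2 * j \<le> M * (Suc j choose 2)" for j
  proof -
    have "j \<le> Suc j choose 2"
      by (cases j) (simp_all add: numeral_2_eq_2)
    thus ?thesis
      using M mult_le_mono by blast
  qed
  have bound: "norm (?f j) \<le> norm q ^ j * 2" for j
  proof -
    have "norm q ^ (M * (Suc j choose 2) - j) \<le> norm q ^ j"
      using q ge[of j] by (intro power_decreasing) auto
    moreover have "norm (1 - q ^ (2 * j + 1)) \<le> norm (1 :: complex) + norm (q ^ (2 * j + 1))"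
      by (rule norm_triangle_ineq4)
    moreover have "norm (q ^ (2 * j + 1)) \<le> 1"
      unfolding norm_power using q by (intro power_le_one) auto
    ultimately show ?thesis
      unfolding norm_mult norm_power by (simp add: norm_power mult_mono)
  qed
  have summable: "summable (\<lambda>j. norm (?f j))"
  proof (rule summable_comparison_test')
    show "summable (\<lambda>j. norm q ^ j * 2)"
      using q by (intro summable_mult2 summable_geometric) auto
  qed (use bound in auto)
  have "?f sums (qpoch_inf (q ^ M) (q ^ M) * qpoch_inf q (q ^ M) * qpoch_inf (q ^ (M - 1)) (q ^ M))"
  proof (cases "q = 0")
    \<comment> \<open>The triple product divides by \<open>z\<close>, so q = 0 is treated apart:
      only the term j = 0 survives, by 0^0 = 1.\<close>
    case True
    have "?f j = 0" if "j \<notin> {0}" for j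
      using that ge[of j] True by auto
    hence sums: "?f sums sum ?f {0}"
      by (intro sums_finite) auto
    have "qpoch_inf (0 :: complex) x = 1" for x
      by (simp add: qpoch_inf_def)
    moreover have "q ^ M = 0" "q ^ (M - 1) = 0"
      using True M by simp_all
    moreover have "sum ?f {0} = 1"
      using True by (simp add: numeral_2_eq_2)
    ultimately show ?thesis
      using sums by (simp only: True mult_1)
  next
    case False
    have norm_w: "norm (q ^ M) < 1"
      using q M by (simp add: norm_power power_less_one_iff)
    have theta: "theta_term (q ^ M) q j = ?f j" for j
    proof -
      have "M * (Suc j choose 2) = (M * (Suc j choose 2) - j) + j"
        using ge[of j] by simp
      hence "q ^ (M * (Suc j choose 2)) = q ^ (M * (Suc j choose 2) - j) * q ^ j"
        by (metis power_add)
      moreover have "q ^ j * (1 / q ^ j - q ^ Suc j) = 1 - q ^ (2 * j + 1)"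
        using False by (simp add: algebra_simps power_add[symmetric] mult_2 mult_2_right)
      ultimately show ?thesis
        by (simp add: theta_term_def power_mult[symmetric] mult.assoc)
    qed
    have "q ^ M / q = q ^ (M - 1)"
      using False M by (cases M) auto
    hence "(\<Sum>j. ?f j) = qpoch_inf (q ^ M) (q ^ M) * qpoch_inf q (q ^ M) * qpoch_inf (q ^ (M - 1)) (q ^ M)"
      using jacobi_triple_product[of "q ^ M" q] norm_w False summable unfolding theta by simp
    thus ?thesis
      using summable_sums[OF summable_norm_cancel[OF summable]] by simp
  qed
  with summable show ?thesis
    by (rule norm_summable_imp_has_sum)
qed

text \<open>Multiplication by (q;q)_\<infinity> cancels the admissible factors and leaves those with
  m congruent to 0, 1 or -1. Partial products of length K * M split into K complete periods with
  three surviving factors each, so the limit is taken along this subsequence.\<close>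

lemma residue_class_product:
  fixes q :: complex
  assumes q: "norm q < 1" and M: "M \<ge> 3"
  shows "(\<Prod>m. if m \<ge> 1 \<and> \<not> [int m = 0] (mod int M) \<and> \<not> [int m = 1] (mod int M)
                \<and> \<not> [int m = - 1] (mod int M) then 1 / (1 - q ^ m) else 1) * qpoch_inf q q
    = qpoch_inf (q ^ M) (q ^ M) * qpoch_inf q (q ^ M) * qpoch_inf (q ^ (M - 1)) (q ^ M)"
proof -
  define good where "good m \<longleftrightarrow> m \<ge> 1 \<and> \<not> [int m = 0] (mod int M) \<and> \<not> [int m = 1] (mod int M)
      \<and> \<not> [int m = - 1] (mod int M)" for m
  define f where "f m = (if good m then 1 / (1 - q ^ m) else 1)" for m
  let ?w = "q ^ M"
  have norm_w: "norm ?w < 1"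
    using q M by (simp add: norm_power power_less_one_iff)
  have f0: "f 0 = 1"
    by (simp add: f_def good_def)
  have "convergent_prod (\<lambda>m. if good m then 1 - q ^ m else 1)"
  proof (rule abs_convergent_prod_imp_convergent_prod, rule summable_imp_abs_convergent_prod)
    show "summable (\<lambda>m. norm ((if good m then 1 - q ^ m else 1) - 1))"
    proof (rule summable_comparison_test')
      show "summable (\<lambda>m. norm q ^ m)"
        using q by (intro summable_geometric) auto
    qed (auto simp: norm_power)
  qed
  hence "convergent_prod (\<lambda>m. inverse (if good m then 1 - q ^ m else 1))"
    by simp
  also have "(\<lambda>m. inverse (if good m then 1 - q ^ m else 1)) = f"
    by (auto simp: f_def fun_eq_iff field_simps)
  finally have "(\<lambda>n. \<Prod>i\<le>n. f i) \<longlonglongrightarrow> prodinf f"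
    by (rule convergent_prod_LIMSEQ)
  hence "(\<lambda>n. \<Prod>m<n. f (Suc m)) \<longlonglongrightarrow> prodinf f"
    by (simp only: prod.atMost_shift f0 mult_1)
  hence "(\<lambda>n. (\<Prod>m<n. f (Suc m)) * qpoch q q n) \<longlonglongrightarrow> prodinf f * qpoch_inf q q"
    by (intro tendsto_mult qpoch_tendsto q)
  hence "((\<lambda>n. (\<Prod>m<n. f (Suc m)) * qpoch q q n) \<circ> (\<lambda>K. K * M)) \<longlonglongrightarrow> prodinf f * qpoch_inf q q"
    by (rule LIMSEQ_subseq_LIMSEQ) (use M in \<open>simp add: strict_mono_def\<close>)
  moreover have "(\<Prod>m<K * M. f (Suc m)) * qpoch q q (K * M)
      = qpoch ?w ?w K * qpoch q ?w K * qpoch (q ^ (M - 1)) ?w K" for K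
  proof -
    define h where "h m = (if good (Suc m) then 1 else 1 - q ^ Suc m)" for m
    have "(\<Prod>m<K * M. f (Suc m)) * qpoch q q (K * M) = (\<Prod>m<K * M. h m)"
      unfolding qpoch_def prod.distrib[symmetric] h_def f_def
      using power_neq_one[OF q] by (intro prod.cong) (auto simp: field_simps)
    also have "\<dots> = (\<Prod>j<K. prod h {j * M..<j * M + M})"
      by (rule prod.nat_group[symmetric])
    also have "\<dots> = (\<Prod>j<K. (1 - ?w * ?w ^ j) * (1 - q * ?w ^ j) * (1 - q ^ (M - 1) * ?w ^ j))"
    proof (intro prod.cong refl)
      fix j
      \<comment> \<open>The factor at position i of a block belongs to m = jM + i + 1, so the
        residues 0, 1, -1 sit at i = M-1, 0, M-2. These are distinct because M is at least
        3.\<close>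
      have good: "good (Suc (j * M + i)) \<longleftrightarrow> i \<notin> {M - 1, 0, M - 2}" if i: "i < M" for i
      proof -
        have "int (Suc (j * M + i)) = int (Suc i) + int j * int M" by simp
        hence "int (Suc (j * M + i)) mod int M = int (Suc i) mod int M"
          by (simp only: mod_mult_self1)
        moreover have "int (Suc i) mod int M = (if i = M - 1 then 0 else int (Suc i))"
          using i M by auto
        moreover have "(-1) mod int M = int M - 1" "1 mod int M = 1"
          using M by (simp_all add: zmod_minus1)
        ultimately show ?thesis
          using i M by (auto simp: good_def cong_def)
      qed
      have "prod h {j * M..<j * M + M} = (\<Prod>i<M. h (j * M + i))"
        using prod.shift_bounds_nat_ivl[of h 0 "j * M" M] by (simp add: atLeast0LessThan add.commute)
      also have "\<dots> = (\<Prod>i\<in>{M - 1, 0, M - 2}. h (j * M + i))"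
        using M good by (intro prod.mono_neutral_right) (auto simp: h_def)
      also have "\<dots> = h (j * M + (M - 1)) * h (j * M) * h (j * M + (M - 2))"
        using M by simp
      also have "h (j * M + (M - 1)) = 1 - ?w * ?w ^ j"
      proof -
        have "Suc (j * M + (M - 1)) = M + M * j" using M by simp
        hence "q ^ Suc (j * M + (M - 1)) = ?w * ?w ^ j"
          by (simp only: power_add power_mult)
        thus ?thesis
          using good[of "M - 1"] M by (simp add: h_def del: power_Suc)
      qed
      also have "h (j * M) = 1 - q * ?w ^ j"
        using good[of 0] M by (simp add: h_def power_mult[symmetric] mult.commute)
      also have "h (j * M + (M - 2)) = 1 - q ^ (M - 1) * ?w ^ j"
      proof -
        have "Suc (j * M + (M - 2)) = (M - 1) + M * j"
          using M by (auto dest!: le_Suc_ex simp: algebra_simps)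
        hence "q ^ Suc (j * M + (M - 2)) = q ^ (M - 1) * ?w ^ j"
          by (simp only: power_add power_mult)
        thus ?thesis
          using good[of "M - 2"] M by (simp add: h_def del: power_Suc)
      qed
      finally show "prod h {j * M..<j * M + M}
          = (1 - ?w * ?w ^ j) * (1 - q * ?w ^ j) * (1 - q ^ (M - 1) * ?w ^ j)" .
    qed
    finally show ?thesis
      by (simp add: qpoch_def prod.distrib)
  qed
  ultimately have "(\<lambda>K. qpoch ?w ?w K * qpoch q ?w K * qpoch (q ^ (M - 1)) ?w K)
      \<longlonglongrightarrow> prodinf f * qpoch_inf q q"
    by (simp add: o_def)
  moreover have "(\<lambda>K. qpoch ?w ?w K * qpoch q ?w K * qpoch (q ^ (M - 1)) ?w K)
      \<longlonglongrightarrow> qpoch_inf ?w ?w * qpoch_inf q ?w * qpoch_inf (q ^ (M - 1)) ?w"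
    by (intro tendsto_mult qpoch_tendsto norm_w)
  ultimately show ?thesis
    unfolding f_def good_def by (rule LIMSEQ_unique)
qed

section \<open>The triple sum\<close>

text \<open>Since terms with r > l vanish, the finite sum extends to all r; its range no longer
  depends on the tuples and r can become an outer variable. Passing to base q^2 yields one factor
  1-q in the numerator and three in the denominator, hence the division by (1-q)^2.\<close>

lemma triple_chain_kernel:
  fixes q :: complex
  assumes "norm q < 1"
  shows "((\<lambda>r. dixon_alpha q r * (bailey_term q r n * (bailey_term q r l * bailey_term q r k))) has_sum
    (qpoch (q ^ 2) q (n + l + k) / (qpoch (q ^ 2) q (n + l) * qpoch (q ^ 2) q (n + k) * qpoch (q ^ 2) q (l + k)
        * qpoch q q n * qpoch q q l * qpoch q q k)) / (1 - q) ^ 2) UNIV"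
proof (rule has_sum_finite_neutralI[of "{..l}"])
  have q1: "1 - q \<noteq> 0"
    using power_neq_one[OF assms, of 0] by simp
  have cancel: "(u * A) / ((u * B) * (u * C) * (u * D) * x * y * z) = A / (B * C * D * x * y * z) / u ^ 2"
    if "u \<noteq> 0" for u A B C D x y z :: complex
    using that by (simp add: power2_eq_square mult_ac)
  have sq: "qpoch q q (Suc m) = (1 - q) * qpoch (q ^ 2) q m" for m
    by (simp only: qpoch_square)
  have "(\<Sum>r\<le>l. dixon_alpha q r * (bailey_term q r n * (bailey_term q r l * bailey_term q r k)))
      = (\<Sum>r\<le>l. dixon_term q l k n r)"
    by (simp add: dixon_term_def[OF assms] bailey_term_def mult_ac)
  also have "\<dots> = qpoch (q ^ 2) q (n + l + k) / (qpoch (q ^ 2) q (n + l) * qpoch (q ^ 2) q (n + k)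
      * qpoch (q ^ 2) q (l + k) * qpoch q q n * qpoch q q l * qpoch q q k) / (1 - q) ^ 2"
    unfolding dixon_sum[OF assms] Suc_eq_plus1[symmetric] sq by (rule cancel[OF q1])
  finally show "(qpoch (q ^ 2) q (n + l + k) / (qpoch (q ^ 2) q (n + l) * qpoch (q ^ 2) q (n + k)
      * qpoch (q ^ 2) q (l + k) * qpoch q q n * qpoch q q l * qpoch q q k)) / (1 - q) ^ 2
    = (\<Sum>r\<le>l. dixon_alpha q r * (bailey_term q r n * (bailey_term q r l * bailey_term q r k)))"
    by simp
qed (auto simp: bailey_term_def)

lemma norm_dixon_alpha_le:
  assumes q: "norm q < 1"
  shows "norm (dixon_alpha q r) \<le> 2 * norm q ^ r"
proof -
  have "r \<le> r ^ 2"
    by (simp add: power2_eq_square)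
  hence "norm q ^ (r ^ 2 + (Suc r choose 2)) \<le> norm q ^ r"
    using q by (intro power_decreasing) auto
  moreover have "norm (1 - q ^ (2 * r + 1)) \<le> norm (1 :: complex) + norm (q ^ (2 * r + 1))"
    by (rule norm_triangle_ineq4)
  moreover have "norm (q ^ (2 * r + 1)) \<le> 1"
    unfolding norm_power using q by (intro power_le_one) auto
  ultimately have "norm q ^ (r ^ 2 + (Suc r choose 2)) * norm (1 - q ^ (2 * r + 1)) \<le> norm q ^ r * 2"
    by (intro mult_mono) auto
  thus ?thesis
    by (simp add: dixon_alpha_def norm_mult norm_power)
qed

lemma triple_chain_has_sum:
  fixes q :: complex
  assumes q: "norm q < 1" and s: "s \<ge> 1"
  shows "((\<lambda>(r, n, l, k). dixon_alpha q r * (chain_term q s r n * (chain_term q s r l * chain_term q s r k)))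
    has_sum (qpoch_inf (q ^ (6 * s + 3)) (q ^ (6 * s + 3)) * qpoch_inf q (q ^ (6 * s + 3))
      * qpoch_inf (q ^ (6 * s + 2)) (q ^ (6 * s + 3))) / qpoch_inf q q ^ 3)
    (UNIV \<times> (nondec_tuples s \<times> nondec_tuples s \<times> nondec_tuples s))"
proof (rule has_sum_SigmaI)
  let ?T = "nondec_tuples s"
  let ?c = "\<lambda>r. q ^ (s * (r ^ 2 + r)) / qpoch_inf q q"
  note chain = chain_term_has_sum[OF q s] chain_term_abs_summable[OF q]
  have norm2: "(\<lambda>p. norm (case p of (l, k) \<Rightarrow> chain_term q s r l * chain_term q s r k)) summable_on ?T \<times> ?T" for r
    using summable_on_times_real[OF chain(2) chain(2)]
    by (simp add: case_prod_unfold norm_mult)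
  have sum3: "((\<lambda>(n, l, k). chain_term q s r n * (chain_term q s r l * chain_term q s r k)) has_sum
      ?c r * (?c r * ?c r)) (?T \<times> ?T \<times> ?T)" for r
    using has_sum_times[OF chain(1) has_sum_times[OF chain(1) chain(1) chain(2) chain(2)] chain(2) norm2]
    by (simp add: case_prod_unfold)
  show "((\<lambda>y. case (r, y) of (r, n, l, k) \<Rightarrow>
      dixon_alpha q r * (chain_term q s r n * (chain_term q s r l * chain_term q s r k))) has_sum
      dixon_alpha q r * (?c r * (?c r * ?c r))) (?T \<times> ?T \<times> ?T)" for r
    using has_sum_cmult_right[OF sum3, of "dixon_alpha q r" r] by (simp add: case_prod_unfold)
  \<comment> \<open>Each of the three chains contributes q^(s(r^2+r)). Together with the exponent of
    \<open>dixon_alpha\<close> they complete the theta exponent with M = 6s+3.\<close>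
  have summand: "dixon_alpha q r * (?c r * (?c r * ?c r))
    = (-1) ^ r * q ^ ((6 * s + 3) * (Suc r choose 2) - r) * (1 - q ^ (2 * r + 1)) * (1 / qpoch_inf q q ^ 3)" for r
  proof -
    have choose: "r ^ 2 + r = 2 * (Suc r choose 2)"
      using mult_self_choose_two[of r] by (simp add: numeral_2_eq_2)
    have "(6 * s + 3) * (Suc r choose 2) - r
        = (r ^ 2 + (Suc r choose 2)) + (s * (r ^ 2 + r) + (s * (r ^ 2 + r) + s * (r ^ 2 + r)))"
    proof -
      have "(6 * s + 3) * (Suc r choose 2) = 3 * (s * (r ^ 2 + r)) + (r ^ 2 + r) + (Suc r choose 2)"
        unfolding choose by (simp add: algebra_simps)
      thus ?thesis by simp
    qed
    hence "q ^ ((6 * s + 3) * (Suc r choose 2) - r) = q ^ (r ^ 2 + (Suc r choose 2))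
        * (q ^ (s * (r ^ 2 + r)) * (q ^ (s * (r ^ 2 + r)) * q ^ (s * (r ^ 2 + r))))"
      by (simp only: power_add)
    thus ?thesis
      by (simp add: dixon_alpha_def power3_eq_cube mult_ac)
  qed
  show "((\<lambda>r. dixon_alpha q r * (?c r * (?c r * ?c r))) has_sum
    (qpoch_inf (q ^ (6 * s + 3)) (q ^ (6 * s + 3)) * qpoch_inf q (q ^ (6 * s + 3))
      * qpoch_inf (q ^ (6 * s + 2)) (q ^ (6 * s + 3))) / qpoch_inf q q ^ 3) UNIV"
    unfolding summand using has_sum_cmult_left[OF theta_series[OF q, of "6 * s + 3"], of "1 / qpoch_inf q q ^ 3"]
    by simp
  \<comment> \<open>Joint absolute summability over r and the three tuples: the majorant is a
    product of a geometric series in r and three copies of \<open>?g\<close>, none of which depends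
    on r.\<close>
  obtain K where K: "K \<ge> 0" "\<And>r n. norm (chain_term q s r n) \<le> K * norm q ^ tuple_weight s n"
    by (rule chain_term_bound[OF q]) blast
  let ?g = "\<lambda>n. K * norm q ^ tuple_weight s n"
  have g: "?g summable_on ?T" "\<And>n. ?g n \<ge> 0"
    using q K(1) by (auto intro!: summable_on_cmult_right summable_on_power_tuples)
  have "(\<lambda>r. 2 * norm q ^ r) summable_on UNIV"
    using q by (intro summable_on_cmult_right summable_nonneg_imp_summable_on summable_geometric) auto
  hence "(\<lambda>(r, y). 2 * norm q ^ r * (case y of (n, x) \<Rightarrow> ?g n * (case x of (l, k) \<Rightarrow> ?g l * ?g k)))
      summable_on UNIV \<times> (?T \<times> ?T \<times> ?T)"
    by (intro summable_on_times_real g) (use g in \<open>auto split: prod.splits\<close>)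
  hence "(\<lambda>p. norm (case p of (r, n, l, k) \<Rightarrow>
      dixon_alpha q r * (chain_term q s r n * (chain_term q s r l * chain_term q s r k))))
      summable_on UNIV \<times> (?T \<times> ?T \<times> ?T)"
    by (rule Infinite_Sum.abs_summable_on_comparison_test')
      (auto simp: norm_mult intro!: mult_mono K norm_dixon_alpha_le[OF q] mult_nonneg_nonneg)
  thus "(\<lambda>(r, n, l, k). dixon_alpha q r * (chain_term q s r n * (chain_term q s r l * chain_term q s r k)))
      summable_on UNIV \<times> (?T \<times> ?T \<times> ?T)"
    by (rule abs_summable_summable)
qed

theorem mainTheorem20:
  fixes s :: nat and q :: complex
  assumes "s \<ge> 1" and "norm q < 1"
  shows "((\<lambda>(n, l, k).
            q ^ (tuple_weight s n + tuple_weight s l + tuple_weight s k)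
              / (diff_prod q s n * diff_prod q s l * diff_prod q s k)
            * (qpoch (q ^ 2) q (n 1 + l 1 + k 1)
              / (qpoch (q ^ 2) q (n 1 + l 1) * qpoch (q ^ 2) q (n 1 + k 1)
                 * qpoch (q ^ 2) q (l 1 + k 1)
                 * qpoch q q (n 1) * qpoch q q (l 1) * qpoch q q (k 1))))
          has_sum
            (1 / qpoch_inf (q ^ 2) q ^ 2
             * (\<Prod>m. if m \<ge> 1 \<and> \<not> [int m = 0] (mod int (6 * s + 3))
                          \<and> \<not> [int m = 1] (mod int (6 * s + 3))
                          \<and> \<not> [int m = - 1] (mod int (6 * s + 3))
                      then 1 / (1 - q ^ m) else 1)))
         (nondec_tuples s \<times> nondec_tuples s \<times> nondec_tuples s)"
    (is "(?f has_sum 1 / ?D ^ 2 * ?P) (?T \<times> ?T \<times> ?T)")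
proof -
  let ?F = "\<lambda>(r, n, l, k). dixon_alpha q r * (chain_term q s r n * (chain_term q s r l * chain_term q s r k))"
  let ?Q = "qpoch_inf q q"
  have q1: "1 - q \<noteq> 0"
    using power_neq_one[OF assms(2), of 0] by simp
  have P: "qpoch_inf (q ^ (6 * s + 3)) (q ^ (6 * s + 3)) * qpoch_inf q (q ^ (6 * s + 3))
      * qpoch_inf (q ^ (6 * s + 2)) (q ^ (6 * s + 3)) = ?P * ?Q"
    using residue_class_product[OF assms(2), of "6 * s + 3"] by simp
  have "((\<lambda>(y, r). ?F (r, y)) has_sum (?P * ?Q) / ?Q ^ 3) ((?T \<times> ?T \<times> ?T) \<times> UNIV)"
    using triple_chain_has_sum[OF assms(2,1)] unfolding P by (subst (asm) has_sum_swap)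
  hence "((\<lambda>y. ?f y / (1 - q) ^ 2) has_sum (?P * ?Q) / ?Q ^ 3) (?T \<times> ?T \<times> ?T)"
  \<comment> \<open>The same joint sum is now fibred the other way: for fixed tuples the sum over r
    rebuilds the kernel.\<close>
  proof (rule has_sum_SigmaD)
    fix y :: "(nat \<Rightarrow> nat) \<times> (nat \<Rightarrow> nat) \<times> (nat \<Rightarrow> nat)"
    obtain n l k where y: "y = (n, l, k)"
      by (cases y)
    let ?w = "q ^ (tuple_weight s n + tuple_weight s l + tuple_weight s k)
        / (diff_prod q s n * diff_prod q s l * diff_prod q s k)"
    have "((\<lambda>r. ?w * (dixon_alpha q r * (bailey_term q r (n 1) * (bailey_term q r (l 1) * bailey_term q r (k 1)))))
        has_sum ?f y / (1 - q) ^ 2) UNIV"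
      using has_sum_cmult_right[OF triple_chain_kernel[OF assms(2)], of ?w "n 1" "l 1" "k 1"]
      unfolding y by (simp add: mult.assoc)
    thus "((\<lambda>r. case (y, r) of (y, r) \<Rightarrow> ?F (r, y)) has_sum ?f y / (1 - q) ^ 2) UNIV"
      unfolding y by (simp add: chain_term_def power_add mult_ac)
  qed
  from has_sum_cmult_right[OF this, of "(1 - q) ^ 2"]
  have "(?f has_sum (1 - q) ^ 2 * ((?P * ?Q) / ?Q ^ 3)) (?T \<times> ?T \<times> ?T)"
    using q1 by simp
  \<comment> \<open>The three chains give (q;q)_\<infinity>^(-3) and the residue product returns one
    factor (q;q)_\<infinity>. With (q;q)_\<infinity> = (1-q) (q^2;q)_\<infinity> the powers of 1-q
    cancel exactly.\<close>
  also have "(1 - q) ^ 2 * ((?P * ?Q) / ?Q ^ 3) = 1 / ?D ^ 2 * ?P"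
  proof -
    have cancel: "u ^ 2 * ((p * (u * d)) / (u * d) ^ 3) = 1 / d ^ 2 * p" if "u \<noteq> 0" "d \<noteq> 0"
      for u d p :: complex
      using that by (simp add: power2_eq_square power3_eq_cube)
    have "?D \<noteq> 0"
      using qpoch_inf_nonzero[OF assms(2)] qpoch_inf_square[OF assms(2)] by auto
    thus ?thesis
      unfolding qpoch_inf_square[OF assms(2), symmetric] by (rule cancel[OF q1])
  qed
  finally show ?thesis .
qed

end
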